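(* Let $N\ge 2$ be an integer and let $m,p,q,\sigma,\tau$ be real numbers. Set $k:=m+q-p+1$ and $\ell:=q+1-\sigma-\tau$, and assume that $1<p\le N+\sigma$, $\min\{k,\ell\}>0$ and $m,q\in[0,\infty)$. Then there exists a positive constant $C=C(m,N,p,q,\sigma,\tau)$ such that for every domain $\Omega\subseteq\mathbb{R}^N$ containing the origin, every positive solution $u$ of $$\mathrm{div}\left(|x|^{\sigma}|\nabla u|^{p-2}\nabla u\right)=|x|^{-\tau}u^q|\nabla u|^m\quad\text{in }\Omega^*:=\Omega\setminus\{0\},$$ and every $r_0>0$ with $\overline{B_{2r_0}(0)}\subset\Omega$, it holds that $$|\nabla u(x)|\le C|x|^{-\frac{\ell}{k}}\quad\text{for every }0<|x|\le r_0.$$ In particular, if $\Omega=\mathbb{R}^N$, then this inequality holds for all $x\in\mathbb{R}^N\setminus\{0\}$.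
   Context: A positive solution of the equation is a positive function $u\in C^2(\Omega^* )$, $\Omega^*=\Omega\setminus\{0\}$, satisfying the equation in the classical sense. $B_r(0)$ is the open ball of radius $r$ centred at $0$ in $\mathbb{R}^N$. The notation $C=C(m,N,p,q,\sigma,\tau)$ means that $C$ depends only on the listed parameters. *)

theory Defs
  imports "HOL-Analysis.Analysis"
begin

definition grad :: "(real^'n \<Rightarrow> real) \<Rightarrow> real^'n \<Rightarrow> real^'n" where
  "grad f x = (\<chi> i. frechet_derivative f (at x) (axis i 1))"

text \<open>The class \<open>C\<^sup>2(S)\<close> for an open set \<open>S\<close>. The Hessian of \<open>f\<close> is the derivative of \<open>grad f\<close>;
  its continuity is stated direction by direction.\<close>

definition C2_on :: "(real^'n) set \<Rightarrow> (real^'n \<Rightarrow> real) \<Rightarrow> bool" where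
  "C2_on S f \<longleftrightarrow>
     (\<forall>x\<in>S. f differentiable (at x)) \<and>
     (\<forall>x\<in>S. grad f differentiable (at x)) \<and>
     (\<forall>v. continuous_on S (\<lambda>x. frechet_derivative (grad f) (at x) v))"

text \<open>\<open>div F(x) = d\<close> in the pointwise sense: the partial derivatives
  \<open>\<partial>F\<^sub>i/\<partial>x\<^sub>i\<close> exist at \<open>x\<close> and sum to \<open>d\<close>.\<close>

definition has_divergence :: "(real^'n \<Rightarrow> real^'n) \<Rightarrow> real \<Rightarrow> real^'n \<Rightarrow> bool" where
  "has_divergence F d x \<longleftrightarrow>
     (\<exists>D. (\<forall>i. ((\<lambda>t. F (x + t *\<^sub>R axis i 1) $ i) has_real_derivative D i) (at 0)) \<and>
          d = (\<Sum>i\<in>UNIV. D i))"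

text \<open>Real powers of \<open>t \<ge> 0\<close> with the convention \<open>0\<^sup>0 = 1\<close>, in contrast to \<open>0 powr 0 = 0\<close>.
  This matters for \<open>|\<nabla>u|\<^sup>m\<close> with \<open>m = 0\<close> at critical points of \<open>u\<close>.\<close>

definition rpow :: "real \<Rightarrow> real \<Rightarrow> real" where
  "rpow t a = (if a = 0 then 1 else t powr a)"

text \<open>The vector field \<open>|x|\<^sup>\<sigma> |\<nabla>u|\<^sup>p\<^sup>-\<^sup>2 \<nabla>u\<close>. Where \<open>\<nabla>u = 0\<close> it takes the value \<open>0\<close>, which is its
  continuous extension when \<open>p > 1\<close>.\<close>

definition flux :: "real \<Rightarrow> real \<Rightarrow> (real^'n \<Rightarrow> real) \<Rightarrow> real^'n \<Rightarrow> real^'n" where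
  "flux p \<sigma> u x = (norm x powr \<sigma> * norm (grad u x) powr (p - 2)) *\<^sub>R grad u x"

text \<open>Functions are total, but for open \<open>\<Omega>\<close> only the values of \<open>u\<close> on \<open>\<Omega> - {0}\<close> matter here.\<close>

definition positive_solution ::
  "real \<Rightarrow> real \<Rightarrow> real \<Rightarrow> real \<Rightarrow> real \<Rightarrow> (real^'n) set \<Rightarrow> (real^'n \<Rightarrow> real) \<Rightarrow> bool" where
  "positive_solution m p q \<sigma> \<tau> \<Omega> u \<longleftrightarrow>
     C2_on (\<Omega> - {0}) u \<and>
     (\<forall>x\<in>\<Omega> - {0}. u x > 0) \<and>
     (\<forall>x\<in>\<Omega> - {0}. has_divergence (flux p \<sigma> u)
        (norm x powr (- \<tau>) * rpow (u x) q * rpow (norm (grad u x)) m) x)"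

end

theory Submission
  imports Defs
begin

text \<open>
  The proof is Bernstein's method on a ball \<open>B(c, r)\<close> with \<open>r \<le> |x|\<close>, \<open>|\<nabla>u(c)| = M\<close> and
  \<open>|\<nabla>u| \<le> \<Lambda>M\<close>: at a maximum of \<open>|\<nabla>u|\<^sup>2 exp(\<kappa>a/(a + u) - B|x - c|\<^sup>2/r\<^sup>2)\<close>, \<open>a = \<delta>Mr\<close>, either
  \<open>u \<le> a\<close>, and the convexity of \<open>\<kappa>a/(a + u)\<close> in \<open>u\<close> gives a contradiction for small \<open>\<delta>\<close>, or \<open>u > a\<close>, and
  \<open>|D\<^sup>2u|\<^sup>2\<close> controls the square of the absorption term, which is then large because of \<open>u > \<delta>Mr\<close>.
  The result is \<open>M\<^sup>k r\<^bsup>q+1\<^esup> \<le> C|x|\<^bsup>\<sigma>+\<tau>\<^esup>\<close>. Maximising \<open>|\<nabla>u|\<close> times a power of the distance to the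
  boundary of a ball provides balls on which \<open>|\<nabla>u| \<le> \<Lambda>M\<close>.

  Since \<open>u\<close> is only \<open>C\<^sup>2\<close>, the equation cannot be differentiated. Instead \<open>|\<nabla>u|\<^sup>2\<close> is replaced by
  the sum of the squared difference quotients \<open>(u(x + \<epsilon>e\<^sub>i) - u(x))/\<epsilon>\<close>, which is \<open>C\<^sup>2\<close>. Differences of the
  equation at \<open>x + \<epsilon>e\<^sub>i\<close> and \<open>x\<close> only involve difference quotients of \<open>C\<^sup>1\<close> functions, so the second-order
  condition at the maxima passes to the limit \<open>\<epsilon> \<rightarrow> 0\<close>.
\<close>

section \<open>Calculus preliminaries\<close>

lemma has_derivative_grad:
  assumes "f differentiable (at x)"
  shows "(f has_derivative (\<lambda>v. grad f x \<bullet> v)) (at x)"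
proof -
  have D: "(f has_derivative frechet_derivative f (at x)) (at x)"
    using assms frechet_derivative_works by blast
  interpret linear "frechet_derivative f (at x)"
    using D has_derivative_linear by blast
  have "frechet_derivative f (at x) v = grad f x \<bullet> v" for v
  proof -
    have "frechet_derivative f (at x) v = frechet_derivative f (at x) (\<Sum>i\<in>UNIV. (v$i) *\<^sub>R axis i 1)"
      using basis_expansion[of v] by (simp add: scalar_mult_eq_scaleR)
    also have "\<dots> = grad f x \<bullet> v"
      by (simp add: sum scale grad_def inner_vec_def mult.commute)
    finally show ?thesis .
  qed
  then have "frechet_derivative f (at x) = (\<lambda>v. grad f x \<bullet> v)" by (rule ext)
  then show ?thesis using D by metis
qed

lemma grad_eqI:
  assumes "(f has_derivative (\<lambda>v. w \<bullet> v)) (at x)"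
  shows "grad f x = w"
  using frechet_derivative_at[OF assms, symmetric] by (simp add: grad_def vec_eq_iff inner_axis)

lemma C2_onI:
  assumes "open S"
    and f: "\<And>x. x \<in> S \<Longrightarrow> (f has_derivative (\<lambda>v. W x \<bullet> v)) (at x)"
    and W: "\<And>x. x \<in> S \<Longrightarrow> (W has_derivative D x) (at x)"
    and D: "\<And>v. continuous_on S (\<lambda>x. D x v)"
  shows "C2_on S f" "\<And>x. x \<in> S \<Longrightarrow> grad f x = W x"
    "\<And>x. x \<in> S \<Longrightarrow> frechet_derivative (grad f) (at x) = D x"
proof -
  show g: "grad f x = W x" if "x \<in> S" for x
    using grad_eqI[OF f[OF that]] .
  have h: "(grad f has_derivative D x) (at x)" if "x \<in> S" for x
    using has_derivative_transform_within_open[OF W[OF that] \<open>open S\<close> that, of "grad f"] g by simp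
  then show d: "frechet_derivative (grad f) (at x) = D x" if "x \<in> S" for x
    using that frechet_derivative_at[of "grad f" "D x" x] by simp
  have "continuous_on S (\<lambda>x. frechet_derivative (grad f) (at x) v)" for v
    by (rule continuous_on_eq[OF D[of v]]) (simp add: d)
  then show "C2_on S f"
    unfolding C2_on_def using f h by (auto simp: differentiable_def)
qed

text \<open>The base point \<open>X n\<close> moves together with the step, so differentiability at
  \<open>x\<close> alone would not do. By the mean value inequality on the segment from
  \<open>X n\<close> to \<open>X n + \<epsilon> n *\<^sub>R e\<close>, the quotient differs from
  \<open>f' (X n) e\<close> by at most an oscillation of the derivative in the direction
  \<open>e\<close>, which continuity makes small. In this way differences of the equation yield its
  derivatives.\<close>

lemma difference_quotient_tendsto:
  fixes f :: "'a::real_normed_vector \<Rightarrow> 'b::real_normed_vector"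
  assumes "open S" "x \<in> S" and f: "\<And>y. y \<in> S \<Longrightarrow> (f has_derivative f' y) (at y)"
    and cont: "continuous_on S (\<lambda>y. f' y e)"
    and X: "X \<longlonglongrightarrow> x" and eps: "\<epsilon> \<longlonglongrightarrow> 0" "\<And>n. \<epsilon> n \<noteq> (0::real)"
  shows "(\<lambda>n. (f (X n + \<epsilon> n *\<^sub>R e) - f (X n)) /\<^sub>R \<epsilon> n) \<longlonglongrightarrow> f' x e"
proof (rule tendstoI)
  fix \<eta> :: real assume "\<eta> > 0"
  \<comment> \<open>The error is at most 3\<mu>: two for the oscillation along the segment, both
    values being compared with the one at \<open>x\<close>, and one for the base point.\<close>
  define \<mu> where "\<mu> = \<eta> / 4"
  have "\<mu> > 0" using \<open>\<eta> > 0\<close> by (simp add: \<mu>_def)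
  have "isCont (\<lambda>y. f' y e) x"
    using cont \<open>open S\<close> \<open>x \<in> S\<close> continuous_on_eq_continuous_at by blast
  then obtain d1 where d1: "d1 > 0" "\<And>y. dist y x < d1 \<Longrightarrow> norm (f' y e - f' x e) < \<mu>"
    using \<open>\<mu> > 0\<close> unfolding continuous_at_eps_delta dist_norm by blast
  obtain d2 where d2: "d2 > 0" "ball x d2 \<subseteq> S"
    using \<open>open S\<close> \<open>x \<in> S\<close> openE by blast
  define d where "d = min d1 d2"
  have "d > 0" using d1 d2 by (simp add: d_def)
  have "(\<lambda>n. \<epsilon> n *\<^sub>R e) \<longlonglongrightarrow> 0" using tendsto_scaleR[OF eps(1) tendsto_const[of e]] by simp
  then have "\<forall>\<^sub>F n in sequentially. dist (\<epsilon> n *\<^sub>R e) 0 < d / 2"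
    using \<open>d > 0\<close> by (intro tendstoD) auto
  moreover have "\<forall>\<^sub>F n in sequentially. dist (X n) x < d / 2"
    using \<open>d > 0\<close> by (intro tendstoD[OF X]) auto
  ultimately show "\<forall>\<^sub>F n in sequentially. dist ((f (X n + \<epsilon> n *\<^sub>R e) - f (X n)) /\<^sub>R \<epsilon> n) (f' x e) < \<eta>"
  proof eventually_elim
    case (elim n)
    let ?p = "\<lambda>t. X n + (t * \<epsilon> n) *\<^sub>R e"
    have p: "dist (?p t) x < d" if "t \<in> {0..1}" for t
    proof -
      have "norm ((t * \<epsilon> n) *\<^sub>R e) \<le> norm (\<epsilon> n *\<^sub>R e)"
        using that by (auto simp: abs_mult mult_left_le_one_le intro!: mult_right_mono)
      then have "norm ((t * \<epsilon> n) *\<^sub>R e) < d/2" using elim by simp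
      moreover have "norm (?p t - x) \<le> norm (X n - x) + norm ((t * \<epsilon> n) *\<^sub>R e)"
        by (metis add.commute add_diff_eq norm_triangle_ineq)
      ultimately show ?thesis using elim unfolding dist_norm by linarith
    qed
    then have pS: "?p t \<in> S" if "t \<in> {0..1}" for t
      using that d2 p[OF that] by (auto simp: d_def dist_commute subset_iff)
    have der: "((\<lambda>t. f (?p t)) has_vector_derivative (\<epsilon> n *\<^sub>R f' (?p t) e)) (at t within {0..1})"
      if t: "t \<in> {0..1}" for t
    proof -
      have lin: "linear (f' (?p t))" using f[OF pS[OF t]] has_derivative_linear by blast
      have "((\<lambda>t. f (?p t)) has_derivative (\<lambda>h. f' (?p t) ((h * \<epsilon> n) *\<^sub>R e))) (at t within {0..1})"
        by (rule has_derivative_compose[where f = "?p", OF _ f[OF pS[OF t]]]) (auto intro!: derivative_eq_intros)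
      then show ?thesis
        unfolding has_vector_derivative_def by (simp add: linear_scale[OF lin])
    qed
    have "norm (f (?p 1) - f (?p 0) - (1 - 0) *\<^sub>R (\<epsilon> n *\<^sub>R f' (?p 0) e)) \<le> norm (1 - 0 :: real) * (\<bar>\<epsilon> n\<bar> * (2 * \<mu>))"
    proof (rule vector_differentiable_bound_linearization[where S = "{0..1}" and f = "\<lambda>t. f (?p t)"
          and f' = "\<lambda>t. \<epsilon> n *\<^sub>R f' (?p t) e"])
      fix t :: real assume t: "t \<in> {0..1}"
      have "norm (f' (?p t) e - f' (?p 0) e) \<le> norm (f' (?p t) e - f' x e) + norm (f' x e - f' (?p 0) e)"
        using norm_triangle_ineq[of "f' (?p t) e - f' x e" "f' x e - f' (?p 0) e"] by simp
      also have "\<dots> \<le> 2 * \<mu>"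
        using d1(2)[of "?p t"] d1(2)[of "?p 0"] p[OF t] p[of 0] by (simp add: d_def norm_minus_commute)
      finally show "norm (\<epsilon> n *\<^sub>R f' (?p t) e - \<epsilon> n *\<^sub>R f' (?p 0) e) \<le> \<bar>\<epsilon> n\<bar> * (2 * \<mu>)"
        by (simp flip: scaleR_diff_right add: mult_left_mono)
    qed (use der in \<open>auto simp: closed_segment_eq_real_ivl\<close>)
    then have 1: "norm (f (X n + \<epsilon> n *\<^sub>R e) - f (X n) - \<epsilon> n *\<^sub>R f' (X n) e) \<le> \<bar>\<epsilon> n\<bar> * (2 * \<mu>)" by simp
    have "(f (X n + \<epsilon> n *\<^sub>R e) - f (X n)) /\<^sub>R \<epsilon> n - f' (X n) e
        = (f (X n + \<epsilon> n *\<^sub>R e) - f (X n) - \<epsilon> n *\<^sub>R f' (X n) e) /\<^sub>R \<epsilon> n"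
      using eps(2) by (simp add: scaleR_diff_right)
    then have "norm ((f (X n + \<epsilon> n *\<^sub>R e) - f (X n)) /\<^sub>R \<epsilon> n - f' (X n) e) \<le> 2 * \<mu>"
      using 1 eps(2)[of n] by (simp add: divide_simps mult.commute)
    moreover have "norm (f' (X n) e - f' x e) < \<mu>"
      using d1(2)[of "X n"] elim \<open>d > 0\<close> by (simp add: d_def)
    ultimately show ?case
      using \<open>\<mu> > 0\<close> norm_triangle_ineq[of "(f (X n + \<epsilon> n *\<^sub>R e) - f (X n)) /\<^sub>R \<epsilon> n - f' (X n) e" "f' (X n) e - f' x e"]
      by (simp add: dist_norm \<mu>_def)
  qed
qed

text \<open>Were \<open>c\<close> positive, \<open>h'\<close> would be positive just to the right of
  0, and the mean value theorem would produce a value above \<open>h 0\<close>.\<close>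

lemma second_derivative_le_0_at_max:
  fixes h :: "real \<Rightarrow> real"
  assumes "d > 0" and h: "\<And>t. \<bar>t\<bar> < d \<Longrightarrow> (h has_real_derivative h' t) (at t)"
    and h': "(h' has_real_derivative c) (at 0)"
    and max: "\<And>t. \<bar>t\<bar> < d \<Longrightarrow> h t \<le> h 0"
  shows "h' 0 = 0" "c \<le> 0"
proof -
  show h0: "h' 0 = 0"
    by (rule DERIV_local_max[OF h[of 0] \<open>d > 0\<close>]) (use max \<open>d > 0\<close> in auto)
  show "c \<le> 0"
  proof (rule ccontr)
    assume "\<not> c \<le> 0"
    then obtain e where e: "e > 0" "\<And>t. 0 < t \<Longrightarrow> t < e \<Longrightarrow> h' 0 < h' t"
      using DERIV_pos_inc_right[OF h'] by auto
    define t where "t = min d e / 2"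
    have t: "0 < t" "t < d" "t < e" using \<open>d > 0\<close> e by (auto simp: t_def)
    obtain s where s: "0 < s" "s < t" "h t - h 0 = t * h' s"
      using MVT2[of 0 t h h'] t h by auto
    have "h' s > 0" using e(2)[of s] s t h0 by simp
    then have "h t > h 0" using s t by (metis diff_gt_0_iff_gt mult_pos_pos)
    then show False using max[of t] t by simp
  qed
qed

text \<open>The first-order condition gives \<open>\<zeta>' 0 = - \<zeta> 0 * \<theta>' 0\<close>.
  Inserted into the second-order condition it eliminates the first derivative of
  \<open>\<zeta>\<close>, and the positive exponential factor cancels.\<close>

lemma exp_weighted_max:
  fixes \<zeta> \<theta> :: "real \<Rightarrow> real"
  assumes "d > 0"
    and z: "\<And>t. \<bar>t\<bar> < d \<Longrightarrow> (\<zeta> has_real_derivative \<zeta>' t) (at t)"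
    and z': "(\<zeta>' has_real_derivative \<zeta>2) (at 0)"
    and th: "\<And>t. \<bar>t\<bar> < d \<Longrightarrow> (\<theta> has_real_derivative \<theta>' t) (at t)"
    and th': "(\<theta>' has_real_derivative \<theta>2) (at 0)"
    and max: "\<And>t. \<bar>t\<bar> < d \<Longrightarrow> \<zeta> t * exp (\<theta> t) \<le> \<zeta> 0 * exp (\<theta> 0)"
  shows "\<zeta>2 \<le> \<zeta> 0 * ((\<theta>' 0)\<^sup>2 - \<theta>2)"
proof -
  let ?h' = "\<lambda>t. (\<zeta>' t + \<zeta> t * \<theta>' t) * exp (\<theta> t)"
  have 1: "((\<lambda>t. \<zeta> t * exp (\<theta> t)) has_real_derivative ?h' t) (at t)" if "\<bar>t\<bar> < d" for t
    by (auto intro!: derivative_eq_intros z th that simp: algebra_simps)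
  have 2: "(?h' has_real_derivative
     (\<zeta>2 + \<zeta>' 0 * \<theta>' 0 + \<zeta> 0 * \<theta>2) * exp (\<theta> 0) + (\<zeta>' 0 + \<zeta> 0 * \<theta>' 0) * (\<theta>' 0 * exp (\<theta> 0))) (at 0)"
    by (auto intro!: derivative_eq_intros z[of 0] th[of 0] z' th' simp: \<open>d > 0\<close> algebra_simps)
  note R = second_derivative_le_0_at_max[OF \<open>d > 0\<close> 1 2 max]
  from R(1) have *: "\<zeta>' 0 = - \<zeta> 0 * \<theta>' 0" by simp
  have "(\<zeta>2 + \<zeta>' 0 * \<theta>' 0 + \<zeta> 0 * \<theta>2) * exp (\<theta> 0) \<le> 0"
    using R(2) * by simp
  then have "\<zeta>2 + \<zeta>' 0 * \<theta>' 0 + \<zeta> 0 * \<theta>2 \<le> 0"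
    using exp_gt_zero[of "\<theta> 0"] by (simp add: mult_le_0_iff)
  then show "\<zeta>2 \<le> \<zeta> 0 * ((\<theta>' 0)\<^sup>2 - \<theta>2)"
    using * by (simp add: algebra_simps power2_eq_square)
qed

section \<open>Functions of class C2\<close>

text \<open>This is the trace of A (I + (p - 2) w w^T). With \<open>A\<close> the Hessian of u and
  \<open>w\<close> the direction of grad u it is the normalised p-Laplacian |grad u|^(2-p) div(|grad
  u|^(p-2) grad u).\<close>

definition p_trace :: "real \<Rightarrow> real^'n \<Rightarrow> (real^'n \<Rightarrow> real^'n) \<Rightarrow> real" where
  "p_trace p w A = (\<Sum>i\<in>UNIV. A (axis i 1) $ i) + (p - 2) * (A w \<bullet> w)"

text \<open>With \<open>c = 1 - \<surd>(p - 1)\<close> one has \<open>(1 - c)\<^sup>2 = p - 1\<close>, so for a unit vector \<open>w\<close> the matrix \<open>I - c w w\<^sup>T\<close> is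
  a square root of \<open>I + (p - 2) w w\<^sup>T\<close>: the normalised \<open>p\<close>-Laplacian becomes a sum of second derivatives
  along the columns, and the one-dimensional second-derivative test suffices.\<close>

definition p_frame :: "real \<Rightarrow> real^'n \<Rightarrow> 'n \<Rightarrow> real^'n" where
  "p_frame p w j = axis j 1 - ((1 - sqrt (p - 1)) * w $ j) *\<^sub>R w"

lemma linear_sum_axis:
  fixes A :: "real^'n \<Rightarrow> 'a::real_vector"
  assumes "linear A"
  shows "A v = (\<Sum>i\<in>UNIV. (v $ i) *\<^sub>R A (axis i 1))"
proof -
  have "A v = A (\<Sum>i\<in>UNIV. (v $ i) *\<^sub>R axis i 1)"
    using basis_expansion[of v] by (simp add: scalar_mult_eq_scaleR)
  then show ?thesis by (simp add: linear_sum[OF assms] linear_scale[OF assms])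
qed

text \<open>With the symmetric matrix P = I - c w w^T this is tr(P A P) = tr(A P^2), written out in
  coordinates.\<close>

lemma sum_p_frame:
  assumes A: "linear A" and w: "norm w = 1" and p: "p > 1"
  shows "(\<Sum>j\<in>UNIV. A (p_frame p w j) \<bullet> p_frame p w j) = p_trace p w A"
proof -
  define c where "c = 1 - sqrt (p - 1)"
  have c: "c\<^sup>2 - 2 * c = p - 2" using p by (simp add: c_def power2_eq_square algebra_simps)
  have s1: "(\<Sum>j\<in>UNIV. w $ j * (A (axis j 1) \<bullet> w)) = A w \<bullet> w"
    by (simp add: linear_sum_axis[OF A, of w] inner_sum_left)
  have s2: "(\<Sum>j\<in>UNIV. w $ j * (A w $ j)) = A w \<bullet> w"
    by (simp add: inner_vec_def mult.commute)
  have s3: "(\<Sum>j\<in>UNIV. w $ j * w $ j) = 1"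
    using w by (metis inner_vec_def inner_real_def dot_square_norm one_power2)
  have "A (p_frame p w j) \<bullet> p_frame p w j = A (axis j 1) $ j - c * (w $ j * (A (axis j 1) \<bullet> w))
      - c * (w $ j * (A w $ j)) + (c * c * (A w \<bullet> w)) * (w $ j * w $ j)" for j
    by (simp add: p_frame_def c_def[symmetric] linear_diff[OF A] linear_scale[OF A] inner_diff_left
        inner_diff_right inner_axis algebra_simps)
  then have "(\<Sum>j\<in>UNIV. A (p_frame p w j) \<bullet> p_frame p w j)
      = (\<Sum>j\<in>UNIV. A (axis j 1) $ j) - c * (A w \<bullet> w) - c * (A w \<bullet> w) + c * c * (A w \<bullet> w)"
    by (simp only: sum.distrib sum_subtractf sum_distrib_left[symmetric] s1 s2 s3 mult_1_right)
  also have "\<dots> = p_trace p w A"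
    unfolding p_trace_def c[symmetric] by (simp add: power2_eq_square algebra_simps)
  finally show ?thesis .
qed

lemma sum_p_frame_inner:
  assumes w: "norm w = 1" and p: "p > 1"
  shows "(\<Sum>j\<in>UNIV. (v \<bullet> p_frame p w j)\<^sup>2) = (norm v)\<^sup>2 + (p - 2) * (v \<bullet> w)\<^sup>2"
proof -
  \<comment> \<open>The previous identity is applied to the rank-one matrix v v^T.\<close>
  have "linear (\<lambda>y. (v \<bullet> y) *\<^sub>R v)"
    by (auto intro!: linearI simp: inner_add_right algebra_simps)
  from sum_p_frame[OF this w p] show ?thesis
    by (simp add: p_trace_def power2_eq_square inner_axis power2_norm_eq_inner[unfolded power2_eq_square]
        inner_vec_def[of v v] mult.commute)
qed

locale C2_fun =
  fixes S :: "(real^'n) set" and u :: "real^'n \<Rightarrow> real"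
  assumes open_S: "open S" and C2: "C2_on S u"
begin

abbreviation "G \<equiv> grad u"
abbreviation "H x \<equiv> frechet_derivative (grad u) (at x)"

lemma u_deriv: "x \<in> S \<Longrightarrow> (u has_derivative (\<lambda>v. G x \<bullet> v)) (at x)"
  using C2 has_derivative_grad by (auto simp: C2_on_def)

lemma G_deriv: "x \<in> S \<Longrightarrow> (G has_derivative H x) (at x)"
  using C2 frechet_derivative_works by (auto simp: C2_on_def)

lemma H_linear: "x \<in> S \<Longrightarrow> linear (H x)"
  using G_deriv has_derivative_linear by blast

lemma H_cont: "continuous_on S (\<lambda>x. H x v)"
  using C2 by (auto simp: C2_on_def)

lemma u_cont: "continuous_on S u"
  by (rule has_derivative_continuous_on[OF has_derivative_at_withinI[OF u_deriv]])

lemma G_cont: "continuous_on S G"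
  by (rule has_derivative_continuous_on[OF has_derivative_at_withinI[OF G_deriv]])

lemma u_line: "x + t *\<^sub>R b \<in> S \<Longrightarrow> ((\<lambda>t. u (x + t *\<^sub>R b)) has_real_derivative G (x + t *\<^sub>R b) \<bullet> b) (at t)"
  unfolding has_field_derivative_def
  by (rule has_derivative_eq_rhs, rule has_derivative_compose[where f = "\<lambda>t. x + t *\<^sub>R b", OF _ u_deriv])
     (auto intro!: derivative_eq_intros simp: mult.commute)

lemma G_line:
  "x + t *\<^sub>R b \<in> S \<Longrightarrow> ((\<lambda>t. G (x + t *\<^sub>R b) \<bullet> v) has_real_derivative H (x + t *\<^sub>R b) b \<bullet> v) (at t)"
  unfolding has_field_derivative_def
  by (rule has_derivative_eq_rhs, rule has_derivative_inner_left,
      rule has_derivative_compose[where f = "\<lambda>t. x + t *\<^sub>R b", OF _ G_deriv])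
     (auto intro!: derivative_eq_intros simp: linear_scale[OF H_linear])

text \<open>Schwarz's theorem: the second-order difference quotient of u along two directions is
  symmetric in them and converges to the Hessian form.\<close>

lemma H_sym:
  assumes "x \<in> S"
  shows "H x v \<bullet> w = H x w \<bullet> v"
proof -
  obtain d where d: "d > 0" "ball x d \<subseteq> S" using open_S assms openE by blast
  define e where "e = d / (norm v + norm w + 1)"
  have pos: "norm v + norm w + 1 > 0" by (smt (verit) norm_ge_zero)
  have e: "e > 0" using d pos by (simp add: e_def)
  have inS: "x + s *\<^sub>R v + t *\<^sub>R w \<in> S" if "\<bar>s\<bar> \<le> e" "\<bar>t\<bar> \<le> e" for s t
  proof -
    have "norm (s *\<^sub>R v + t *\<^sub>R w) \<le> \<bar>s\<bar> * norm v + \<bar>t\<bar> * norm w"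
      by (rule norm_triangle_le) simp
    also have "\<dots> \<le> e * norm v + e * norm w" using that by (intro add_mono mult_right_mono) auto
    also have "\<dots> < e * (norm v + norm w + 1)" using e by (simp add: algebra_simps)
    also have "\<dots> = d" using pos by (simp add: e_def)
    finally have "x + (s *\<^sub>R v + t *\<^sub>R w) \<in> ball x d" unfolding mem_ball dist_commute[of x] by (simp add: dist_norm)
    then show ?thesis using d by (simp add: add.assoc subset_iff)
  qed
  define \<epsilon> where "\<epsilon> n = e / real (Suc n)" for n
  have eps: "\<epsilon> n > 0" "\<epsilon> n \<le> e" for n using e by (auto simp: \<epsilon>_def divide_simps)
  have eps0: "\<epsilon> \<longlonglongrightarrow> 0" unfolding \<epsilon>_def by (rule LIMSEQ_Suc[OF lim_const_over_n])
  have key: "(\<lambda>n. (u (x + \<epsilon> n *\<^sub>R a + \<epsilon> n *\<^sub>R b) - u (x + \<epsilon> n *\<^sub>R a) - u (x + \<epsilon> n *\<^sub>R b) + u x) / (\<epsilon> n)\<^sup>2)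
       \<longlonglongrightarrow> H x b \<bullet> a" if inS: "\<And>s t. \<bar>s\<bar> \<le> e \<Longrightarrow> \<bar>t\<bar> \<le> e \<Longrightarrow> x + s *\<^sub>R a + t *\<^sub>R b \<in> S" for a b
  proof -
    \<comment> \<open>The mean value theorem in the direction \<open>a\<close> turns the second
      difference of u into a first difference of \<open>G\<close> in the direction \<open>b\<close>,
      based at the moving point \<open>x + \<xi> *\<^sub>R a\<close>; its quotient converges by
      \<open>difference_quotient_tendsto\<close>.\<close>
    have "\<exists>\<xi>. 0 < \<xi> \<and> \<xi> < \<epsilon> n \<and> u (x + \<epsilon> n *\<^sub>R a + \<epsilon> n *\<^sub>R b) - u (x + \<epsilon> n *\<^sub>R a) - u (x + \<epsilon> n *\<^sub>R b) + u x
        = \<epsilon> n * (G (x + \<xi> *\<^sub>R a + \<epsilon> n *\<^sub>R b) \<bullet> a - G (x + \<xi> *\<^sub>R a) \<bullet> a)" for n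
    proof -
      have "((\<lambda>s. u ((x + \<epsilon> n *\<^sub>R b) + s *\<^sub>R a) - u (x + s *\<^sub>R a)) has_real_derivative
          G ((x + \<epsilon> n *\<^sub>R b) + s *\<^sub>R a) \<bullet> a - G (x + s *\<^sub>R a) \<bullet> a) (at s)" if "0 \<le> s" "s \<le> \<epsilon> n" for s
        using inS[of s "\<epsilon> n"] inS[of s 0] that eps[of n]
        by (intro DERIV_diff u_line) (auto simp: algebra_simps)
      from MVT2[of 0 "\<epsilon> n", OF eps(1) this]
      obtain \<xi> where "0 < \<xi>" "\<xi> < \<epsilon> n" "u ((x + \<epsilon> n *\<^sub>R b) + \<epsilon> n *\<^sub>R a) - u (x + \<epsilon> n *\<^sub>R a) - (u (x + \<epsilon> n *\<^sub>R b) - u x)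
          = \<epsilon> n * (G ((x + \<epsilon> n *\<^sub>R b) + \<xi> *\<^sub>R a) \<bullet> a - G (x + \<xi> *\<^sub>R a) \<bullet> a)" by auto
      then show ?thesis by (intro exI[of _ \<xi>]) (simp add: algebra_simps)
    qed
    then obtain \<xi> where xi: "\<And>n. 0 < \<xi> n" "\<And>n. \<xi> n < \<epsilon> n"
      "\<And>n. u (x + \<epsilon> n *\<^sub>R a + \<epsilon> n *\<^sub>R b) - u (x + \<epsilon> n *\<^sub>R a) - u (x + \<epsilon> n *\<^sub>R b) + u x
        = \<epsilon> n * (G (x + \<xi> n *\<^sub>R a + \<epsilon> n *\<^sub>R b) \<bullet> a - G (x + \<xi> n *\<^sub>R a) \<bullet> a)" by metis
    have "\<xi> \<longlonglongrightarrow> 0"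
      by (rule tendsto_sandwich[OF _ _ tendsto_const eps0]) (auto intro!: always_eventually less_imp_le xi)
    from tendsto_add[OF tendsto_const[of x] tendsto_scaleR[OF this tendsto_const[of a]]]
    have "(\<lambda>n. x + \<xi> n *\<^sub>R a) \<longlonglongrightarrow> x" by simp
    from difference_quotient_tendsto[OF open_S assms G_deriv H_cont this eps0, of b] eps(1)
    have "(\<lambda>n. (G (x + \<xi> n *\<^sub>R a + \<epsilon> n *\<^sub>R b) - G (x + \<xi> n *\<^sub>R a)) /\<^sub>R \<epsilon> n) \<longlonglongrightarrow> H x b"
      by (simp add: less_imp_neq[symmetric])
    from tendsto_inner[OF this tendsto_const[of a]]
    moreover have "inverse (\<epsilon> n) * z = \<epsilon> n * z / (\<epsilon> n)\<^sup>2" for n z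
      using eps(1)[of n] by (simp add: power2_eq_square divide_simps)
    ultimately show ?thesis
      unfolding xi(3) by (simp add: inner_diff_left)
  qed
  have sw: "x + a + b = x + b + a" for a b :: "real^'n"
    by (simp add: ac_simps)
  have inS': "x + s *\<^sub>R w + t *\<^sub>R v \<in> S" if "\<bar>s\<bar> \<le> e" "\<bar>t\<bar> \<le> e" for s t
    using inS[OF that(2,1)] by (subst sw)
  have "(\<lambda>n. (u (x + \<epsilon> n *\<^sub>R w + \<epsilon> n *\<^sub>R v) - u (x + \<epsilon> n *\<^sub>R w) - u (x + \<epsilon> n *\<^sub>R v) + u x) / (\<epsilon> n)\<^sup>2)
      = (\<lambda>n. (u (x + \<epsilon> n *\<^sub>R v + \<epsilon> n *\<^sub>R w) - u (x + \<epsilon> n *\<^sub>R v) - u (x + \<epsilon> n *\<^sub>R w) + u x) / (\<epsilon> n)\<^sup>2)"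
  proof
    fix n
    show "(u (x + \<epsilon> n *\<^sub>R w + \<epsilon> n *\<^sub>R v) - u (x + \<epsilon> n *\<^sub>R w) - u (x + \<epsilon> n *\<^sub>R v) + u x) / (\<epsilon> n)\<^sup>2
      = (u (x + \<epsilon> n *\<^sub>R v + \<epsilon> n *\<^sub>R w) - u (x + \<epsilon> n *\<^sub>R v) - u (x + \<epsilon> n *\<^sub>R w) + u x) / (\<epsilon> n)\<^sup>2"
      unfolding sw[of "\<epsilon> n *\<^sub>R w" "\<epsilon> n *\<^sub>R v"] by simp
  qed
  from key[of w v, OF inS', unfolded this] show ?thesis
    using LIMSEQ_unique[OF key[of v w, OF inS]] by simp
qed

text \<open>Continuity of the Hessian in each fixed direction gives joint continuity, by expanding
  the moving vector in the finite standard basis.\<close>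

lemma H_tendsto:
  assumes "x \<in> S" "X \<longlonglongrightarrow> x" "V \<longlonglongrightarrow> v"
  shows "(\<lambda>n. H (X n) (V n)) \<longlonglongrightarrow> H x v"
proof -
  have h: "(\<lambda>n. H (X n) b) \<longlonglongrightarrow> H x b" for b
    by (rule continuous_on_tendsto_compose[OF H_cont assms(2,1) topological_tendstoD[OF assms(2) open_S assms(1)]])
  have "(\<lambda>n. \<Sum>i\<in>UNIV. (V n $ i) *\<^sub>R H (X n) (axis i 1)) \<longlonglongrightarrow> (\<Sum>i\<in>UNIV. (v $ i) *\<^sub>R H x (axis i 1))"
    using assms(3) by (intro tendsto_sum tendsto_scaleR h) (rule tendsto_vec_nth)
  moreover have "\<forall>\<^sub>F n in sequentially. (\<Sum>i\<in>UNIV. (V n $ i) *\<^sub>R H (X n) (axis i 1)) = H (X n) (V n)"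
    using topological_tendstoD[OF assms(2) open_S assms(1)]
    by (rule eventually_mono) (rule linear_sum_axis[OF H_linear, symmetric])
  ultimately show ?thesis
    unfolding linear_sum_axis[OF H_linear[OF assms(1)], of v]
    by (rule Lim_transform_eventually)
qed

end

section \<open>The second-order condition at a maximum\<close>

context C2_fun
begin

text \<open>For fixed \<delta> the difference quotients of u are again of class C2, so
  \<open>exp_weighted_max\<close> applies along every line through \<open>y\<close>. Summing over
  the columns of \<open>p_frame\<close> assembles the directional inequalities into one for the
  operator whose coefficients are frozen at \<open>w\<close>.\<close>

lemma discrete_bernstein:
  assumes "C2_on S \<theta>" and p: "p > 1" and w: "norm w = 1"
    and "d > 0" and y: "ball y d \<subseteq> S" and yi: "\<And>i. ball (y + \<delta> *\<^sub>R axis i 1) d \<subseteq> S"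
    and max: "\<And>x. x \<in> ball y d \<Longrightarrow>
      (\<Sum>i\<in>UNIV. ((u (x + \<delta> *\<^sub>R axis i 1) - u x) / \<delta>)\<^sup>2) * exp (\<theta> x)
      \<le> (\<Sum>i\<in>UNIV. ((u (y + \<delta> *\<^sub>R axis i 1) - u y) / \<delta>)\<^sup>2) * exp (\<theta> y)"
  defines "D i \<equiv> (G (y + \<delta> *\<^sub>R axis i 1) - G y) /\<^sub>R \<delta>"
    and "W i \<equiv> (u (y + \<delta> *\<^sub>R axis i 1) - u y) / \<delta>"
  shows "2 * (\<Sum>i\<in>UNIV. (norm (D i))\<^sup>2 + (p - 2) * (D i \<bullet> w)\<^sup>2)
    + 2 * (\<Sum>i\<in>UNIV. W i * ((p_trace p w (H (y + \<delta> *\<^sub>R axis i 1)) - p_trace p w (H y)) / \<delta>))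
    \<le> (\<Sum>i\<in>UNIV. (W i)\<^sup>2) * ((norm (grad \<theta> y))\<^sup>2 + (p - 2) * (grad \<theta> y \<bullet> w)\<^sup>2
        - p_trace p w (frechet_derivative (grad \<theta>) (at y)))"
proof -
  interpret T: C2_fun S \<theta> using assms(1) open_S by unfold_locales
  let ?y = "\<lambda>i. y + \<delta> *\<^sub>R axis i 1"
  have yS: "y \<in> S" using y \<open>d > 0\<close> centre_in_ball by blast
  have yiS: "?y i \<in> S" for i using yi[of i] \<open>d > 0\<close> centre_in_ball by blast
  have dir: "(\<Sum>i\<in>UNIV. 2 * (D i \<bullet> b)\<^sup>2 + 2 * (W i * ((H (?y i) b \<bullet> b - H y b \<bullet> b) / \<delta>)))
      \<le> (\<Sum>i\<in>UNIV. (W i)\<^sup>2) * ((T.G y \<bullet> b)\<^sup>2 - T.H y b \<bullet> b)" for b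
  proof -
    define e where "e = d / (norm b + 1)"
    have pos: "norm b + 1 > 0" by (smt (verit) norm_ge_zero)
    have e: "e > 0" using \<open>d > 0\<close> pos by (simp add: e_def)
    have inb: "x + t *\<^sub>R b \<in> ball x d" if "\<bar>t\<bar> < e" for t x
    proof -
      have "norm (t *\<^sub>R b) \<le> e * norm b" using that by (simp add: mult_right_mono)
      also have "\<dots> < e * (norm b + 1)" using e by simp
      also have "\<dots> = d" using pos by (simp add: e_def)
      finally show ?thesis unfolding mem_ball dist_commute[of x] by (simp add: dist_norm)
    qed
    have inS: "y + t *\<^sub>R b \<in> S" "?y i + t *\<^sub>R b \<in> S" if "\<bar>t\<bar> < e" for t i
      using inb[OF that] y yi by blast+
    let ?W = "\<lambda>i t. (u (?y i + t *\<^sub>R b) - u (y + t *\<^sub>R b)) / \<delta>"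
    let ?W' = "\<lambda>i t. (G (?y i + t *\<^sub>R b) \<bullet> b - G (y + t *\<^sub>R b) \<bullet> b) / \<delta>"
    have W: "(?W i has_real_derivative ?W' i t) (at t)" if "\<bar>t\<bar> < e" for i t
      by (intro DERIV_cdivide DERIV_diff u_line inS that)
    have W': "(?W' i has_real_derivative (H (?y i) b \<bullet> b - H y b \<bullet> b) / \<delta>) (at 0)" for i
      using G_line[of _ 0 b b] yS yiS by (intro DERIV_cdivide DERIV_diff) auto
    have z: "((\<lambda>t. \<Sum>i\<in>UNIV. (?W i t)\<^sup>2) has_real_derivative (\<Sum>i\<in>UNIV. 2 * (?W i t * ?W' i t))) (at t)"
      if "\<bar>t\<bar> < e" for t
      by (rule DERIV_sum, rule DERIV_cong, rule DERIV_power[OF W[OF that]]) simp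
    have z': "((\<lambda>t. \<Sum>i\<in>UNIV. 2 * (?W i t * ?W' i t)) has_real_derivative
        (\<Sum>i\<in>UNIV. 2 * (?W' i 0 * ?W' i 0 + ((H (?y i) b \<bullet> b - H y b \<bullet> b) / \<delta>) * ?W i 0))) (at 0)"
      using e by (intro DERIV_sum DERIV_cmult DERIV_mult W W') auto
    have th: "((\<lambda>t. \<theta> (y + t *\<^sub>R b)) has_real_derivative T.G (y + t *\<^sub>R b) \<bullet> b) (at t)" if "\<bar>t\<bar> < e" for t
      by (intro T.u_line inS that)
    have th': "((\<lambda>t. T.G (y + t *\<^sub>R b) \<bullet> b) has_real_derivative T.H y b \<bullet> b) (at 0)"
      using T.G_line[of y 0 b b] yS by simp
    have "(\<Sum>i\<in>UNIV. (?W i t)\<^sup>2) * exp (\<theta> (y + t *\<^sub>R b)) \<le> (\<Sum>i\<in>UNIV. (?W i 0)\<^sup>2) * exp (\<theta> (y + 0 *\<^sub>R b))"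
      if "\<bar>t\<bar> < e" for t
      using max[OF inb[OF that]] by (simp add: ac_simps)
    from exp_weighted_max[OF e z z' th th' this]
    have "(\<Sum>i\<in>UNIV. 2 * (?W' i 0 * ?W' i 0 + ((H (?y i) b \<bullet> b - H y b \<bullet> b) / \<delta>) * ?W i 0))
       \<le> (\<Sum>i\<in>UNIV. (?W i 0)\<^sup>2) * ((T.G (y + 0 *\<^sub>R b) \<bullet> b)\<^sup>2 - T.H y b \<bullet> b)" .
    moreover have e1: "?W' i 0 = D i \<bullet> b" for i
      by (simp add: D_def inner_diff_left divide_inverse mult.commute)
    moreover have e2: "?W i 0 = W i" for i
      by (simp add: W_def)
    ultimately show ?thesis
      unfolding e1 e2 by (simp add: power2_eq_square distrib_left mult.commute)
  qed
  let ?b = "p_frame p w"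
  have "(\<Sum>j\<in>UNIV. \<Sum>i\<in>UNIV. 2 * (D i \<bullet> ?b j)\<^sup>2 + 2 * (W i * ((H (?y i) (?b j) \<bullet> ?b j - H y (?b j) \<bullet> ?b j) / \<delta>)))
     \<le> (\<Sum>j\<in>UNIV. (\<Sum>i\<in>UNIV. (W i)\<^sup>2) * ((T.G y \<bullet> ?b j)\<^sup>2 - T.H y (?b j) \<bullet> ?b j))"
    by (intro sum_mono dir)
  also have "\<dots> = (\<Sum>i\<in>UNIV. (W i)\<^sup>2) * ((norm (T.G y))\<^sup>2 + (p - 2) * (T.G y \<bullet> w)\<^sup>2 - p_trace p w (T.H y))"
    by (simp only: sum_distrib_left[symmetric] sum_subtractf sum_p_frame[OF T.H_linear[OF yS] w p] sum_p_frame_inner[OF w p])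
  also have "(\<Sum>j\<in>UNIV. \<Sum>i\<in>UNIV. 2 * (D i \<bullet> ?b j)\<^sup>2 + 2 * (W i * ((H (?y i) (?b j) \<bullet> ?b j - H y (?b j) \<bullet> ?b j) / \<delta>)))
     = (\<Sum>i\<in>UNIV. \<Sum>j\<in>UNIV. 2 * (D i \<bullet> ?b j)\<^sup>2 + 2 * (W i * ((H (?y i) (?b j) \<bullet> ?b j - H y (?b j) \<bullet> ?b j) / \<delta>)))"
    by (rule sum.swap)
  also have "\<dots> = (\<Sum>i\<in>UNIV. 2 * ((norm (D i))\<^sup>2 + (p - 2) * (D i \<bullet> w)\<^sup>2)
        + 2 * (W i * ((p_trace p w (H (?y i)) - p_trace p w (H y)) / \<delta>)))"
    by (simp only: sum.distrib sum_distrib_left[symmetric] sum_subtractf sum_divide_distrib[symmetric]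
        sum_p_frame[OF H_linear[OF yS] w p] sum_p_frame[OF H_linear[OF yiS] w p] sum_p_frame_inner[OF w p])
  finally show ?thesis unfolding sum_distrib_left sum.distrib[symmetric] .
qed

text \<open>Differentiating a normalised vector projects onto its orthogonal complement. Off the
  critical set the direction of the gradient, which enters the coefficients of the equation, can
  thus be differenced like a C^1 map.\<close>

lemma sgn_G_deriv:
  assumes "x \<in> S" "G x \<noteq> 0"
  shows "((\<lambda>x. sgn (G x)) has_derivative
    (\<lambda>v. (H x v - (H x v \<bullet> sgn (G x)) *\<^sub>R sgn (G x)) /\<^sub>R norm (G x))) (at x)"
proof -
  have 1: "((\<lambda>x. norm (G x)) has_derivative (\<lambda>v. H x v \<bullet> sgn (G x))) (at x)"
    by (rule has_derivative_compose[OF G_deriv[OF assms(1)] has_derivative_norm[OF assms(2)]])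
  have 2: "((\<lambda>x. inverse (norm (G x))) has_derivative
      (\<lambda>v. - (inverse (norm (G x)) * (H x v \<bullet> sgn (G x)) * inverse (norm (G x))))) (at x)"
    using assms(2) by (intro Deriv.has_derivative_inverse[OF _ 1]) simp
  have "(\<lambda>x. sgn (G x)) = (\<lambda>x. inverse (norm (G x)) *\<^sub>R G x)"
    by (simp add: sgn_div_norm)
  moreover have "(H x v - (H x v \<bullet> sgn (G x)) *\<^sub>R sgn (G x)) /\<^sub>R norm (G x) = inverse (norm (G x)) *\<^sub>R H x v
         + (- (inverse (norm (G x)) * (H x v \<bullet> sgn (G x)) * inverse (norm (G x)))) *\<^sub>R G x" for v
    by (subst (2) sgn_div_norm) (simp add: scaleR_diff_right ac_simps)
  ultimately show ?thesis
    using has_derivative_scaleR[OF 2 G_deriv[OF assms(1)]] by presburger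
qed

lemma sgn_G_deriv_cont:
  "continuous_on {x \<in> S. G x \<noteq> 0} (\<lambda>x. (H x v - (H x v \<bullet> sgn (G x)) *\<^sub>R sgn (G x)) /\<^sub>R norm (G x))"
proof -
  have "continuous_on {x \<in> S. G x \<noteq> 0} G" "continuous_on {x \<in> S. G x \<noteq> 0} (\<lambda>x. H x v)"
    using continuous_on_subset[OF G_cont] continuous_on_subset[OF H_cont] by auto
  then show ?thesis unfolding sgn_div_norm by (intro continuous_intros) auto
qed

lemma open_noncritical: "open {x \<in> S. G x \<noteq> 0}"
  using continuous_open_preimage[OF G_cont open_S open_Compl[OF closed_singleton[of 0]]]
  by (simp add: vimage_def Int_def)

text \<open>The inequality is the one that differentiating the equation would give if u had three
  derivatives. Here \<open>X\<close> is a limit of maximum points of the discrete functions;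
  \<open>bd\<close> keeps it off the sphere, so that \<open>discrete_bernstein\<close> applies at
  the nearby discrete maxima.\<close>

lemma bernstein_at_max:
  fixes g :: "real^'n \<Rightarrow> real"
  assumes p: "p > 1" and cball: "cball c r \<subseteq> S" and \<theta>: "C2_on S \<theta>"
    and eq: "\<And>x. x \<in> S \<Longrightarrow> G x \<noteq> 0 \<Longrightarrow> p_trace p (sgn (G x)) (H x) = g x"
    and g: "\<And>x. x \<in> S \<Longrightarrow> G x \<noteq> 0 \<Longrightarrow> (g has_derivative g' x) (at x)"
    and g': "\<And>e. continuous_on {x \<in> S. G x \<noteq> 0} (\<lambda>x. g' x e)"
    and y0: "y0 \<in> cball c r" "G y0 \<noteq> 0"
    and bd: "\<And>x. x \<in> sphere c r \<Longrightarrow> (norm (G x))\<^sup>2 * exp (\<theta> x) < (norm (G y0))\<^sup>2 * exp (\<theta> y0)"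
  obtains X where "X \<in> ball c r" "G X \<noteq> 0"
    "\<And>x. x \<in> cball c r \<Longrightarrow> (norm (G x))\<^sup>2 * exp (\<theta> x) \<le> (norm (G X))\<^sup>2 * exp (\<theta> X)"
    "2 *\<^sub>R H X (G X) = - (norm (G X))\<^sup>2 *\<^sub>R grad \<theta> X"
    "(\<Sum>i\<in>UNIV. (norm (H X (axis i 1)))\<^sup>2) + g' X (G X) \<le> (norm (G X))\<^sup>2 *
      (p / 4 * (norm (grad \<theta> X))\<^sup>2 - p_trace p (sgn (G X)) (frechet_derivative (grad \<theta>) (at X)) / 2)"
proof -
  interpret T: C2_fun S \<theta> using \<theta> open_S by unfold_locales

  \<comment> \<open>Discrete maxima and their limit point\<close>
  obtain \<rho> where \<rho>0: "\<rho> > 0" "(\<Union>x\<in>cball c r. ball x \<rho>) \<subseteq> S"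
    by (rule compact_subset_open_imp_ball_epsilon_subset[OF compact_cball open_S cball])
  have \<rho>: "\<rho> > 0" "ball x \<rho> \<subseteq> S" if "x \<in> cball c r" for x
    using \<rho>0 that by (auto simp: UN_subset_iff)
  define \<epsilon> where "\<epsilon> n = (\<rho> / 2) / real (Suc n)" for n
  have eps: "\<epsilon> n > 0" "\<epsilon> n \<le> \<rho> / 2" for n using \<rho>0 by (auto simp: \<epsilon>_def divide_simps)
  have eps0: "\<epsilon> \<longlonglongrightarrow> 0" unfolding \<epsilon>_def by (rule LIMSEQ_Suc[OF lim_const_over_n])
  have sh: "ball (x + \<epsilon> n *\<^sub>R axis i 1) (\<rho> / 2) \<subseteq> S" if "x \<in> cball c r" for x n i
  proof -
    have d: "dist x (x + \<epsilon> n *\<^sub>R axis i 1) \<le> \<rho> / 2" using eps[of n] by (simp add: dist_norm)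
    have "ball (x + \<epsilon> n *\<^sub>R axis i 1) (\<rho> / 2) \<subseteq> ball x \<rho>"
    proof
      fix z assume "z \<in> ball (x + \<epsilon> n *\<^sub>R axis i 1) (\<rho> / 2)"
      then show "z \<in> ball x \<rho>"
        using dist_triangle[of x z "x + \<epsilon> n *\<^sub>R axis i 1"] d by simp
    qed
    then show ?thesis using \<rho>(2)[OF that] by blast
  qed
  have shS: "x + \<epsilon> n *\<^sub>R axis i 1 \<in> S" if "x \<in> cball c r" for x n i
    by (rule subsetD[OF sh[OF that, of n i]]) (simp add: \<rho>0(1))
  let ?w = "\<lambda>n i x. (u (x + \<epsilon> n *\<^sub>R axis i 1) - u x) / \<epsilon> n"
  let ?Q = "\<lambda>n x. (\<Sum>i\<in>UNIV. (?w n i x)\<^sup>2) * exp (\<theta> x)"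
  let ?P = "\<lambda>x. (norm (G x))\<^sup>2 * exp (\<theta> x)"
  have "\<exists>x\<in>cball c r. \<forall>y\<in>cball c r. ?Q n y \<le> ?Q n x" for n
  proof (rule continuous_attains_sup)
    have u1: "continuous_on (cball c r) u" "continuous_on (cball c r) \<theta>"
      using continuous_on_subset[OF u_cont cball] continuous_on_subset[OF T.u_cont cball] by auto
    have u2: "continuous_on (cball c r) (\<lambda>x. u (x + \<epsilon> n *\<^sub>R axis i 1))" for i
      by (rule continuous_on_compose2[OF u_cont]) (use shS in \<open>auto intro!: continuous_intros\<close>)
    show "continuous_on (cball c r) (?Q n)"
      using eps[of n] by (intro continuous_intros u1 u2) auto
    show "cball c r \<noteq> {}" using y0(1) by blast
  qed auto
  then obtain Y where Y: "\<And>n. Y n \<in> cball c r" "\<And>n y. y \<in> cball c r \<Longrightarrow> ?Q n y \<le> ?Q n (Y n)"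
    by metis
  obtain X \<phi> where X: "X \<in> cball c r" and \<phi>: "strict_mono \<phi>" and lim: "(Y \<circ> \<phi>) \<longlonglongrightarrow> X"
    using compact_cball[of c r, unfolded compact_def, rule_format, of Y] Y(1) by blast
  define y where "y n = Y (\<phi> n)" for n
  define \<delta> where "\<delta> n = \<epsilon> (\<phi> n)" for n
  have y: "y \<longlonglongrightarrow> X" using lim by (simp add: y_def[abs_def] comp_def)
  have \<delta>: "\<delta> \<longlonglongrightarrow> 0" using LIMSEQ_subseq_LIMSEQ[OF eps0 \<phi>] by (simp add: \<delta>_def[abs_def] comp_def)
  have \<delta>0: "\<delta> n > 0" "\<delta> n \<noteq> 0" for n using eps(1)[of "\<phi> n"] by (auto simp: \<delta>_def)
  have XS: "X \<in> S" using X cball by blast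
  have wlim: "(\<lambda>n. (u (z n + \<delta> n *\<^sub>R axis i 1) - u (z n)) / \<delta> n) \<longlonglongrightarrow> G x $ i"
    if "z \<longlonglongrightarrow> x" "x \<in> S" for z x i
  proof -
    have "continuous_on S (\<lambda>y. G y \<bullet> axis i 1)" by (intro continuous_intros G_cont)
    from difference_quotient_tendsto[OF open_S that(2) u_deriv this that(1) \<delta> \<delta>0(2)]
    show ?thesis by (simp add: inner_axis divide_inverse mult.commute)
  qed
  have Qlim: "(\<lambda>n. ?Q (\<phi> n) (z n)) \<longlonglongrightarrow> ?P x" if "z \<longlonglongrightarrow> x" "x \<in> S" "\<And>n. z n \<in> S" for z x
  proof -
    have "(\<lambda>n. ?Q (\<phi> n) (z n)) \<longlonglongrightarrow> (\<Sum>i\<in>UNIV. (G x $ i)\<^sup>2) * exp (\<theta> x)"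
      using wlim[OF that(1,2)] continuous_on_tendsto_compose[OF T.u_cont that(1,2)] that(3)
      by (intro tendsto_intros) (auto simp: \<delta>_def)
    then show ?thesis by (simp add: norm_vec_def L2_set_def sum_nonneg)
  qed
  have yc: "y n \<in> cball c r" for n using Y(1) by (simp add: y_def)
  then have yS: "y n \<in> S" for n using cball by blast
  \<comment> \<open>The maximality of \<open>y n\<close> for the discrete function passes to the
    limit, since both sides converge.\<close>
  have Pmax: "?P x \<le> ?P X" if "x \<in> cball c r" for x
  proof (rule LIMSEQ_le[OF Qlim[of "\<lambda>_. x" x] Qlim[OF y XS yS]])
    show "\<exists>N. \<forall>n\<ge>N. ?Q (\<phi> n) x \<le> ?Q (\<phi> n) (y n)" using Y(2)[OF that] by (simp add: y_def)
  qed (use that cball in auto)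
  have "0 < ?P y0" using y0(2) by simp
  then have GX: "G X \<noteq> 0" using Pmax[OF y0(1)] by auto
  have Xb: "X \<in> ball c r"
    using bd[of X] Pmax[OF y0(1)] X by (force simp: less_le)
  define N where "N = sgn (G X)"
  have N1: "norm N = 1" using GX by (simp add: N_def norm_sgn)
  define W where "W = grad \<theta> X"
  \<comment> \<open>The function |grad u|^2 exp(\<theta>) is itself of class C^1, so its first-order
    condition at the interior maximum \<open>X\<close> holds exactly; symmetry of the Hessian moves
    it onto \<open>G X\<close>.\<close>
  have HG: "2 *\<^sub>R H X (G X) = - (norm (G X))\<^sup>2 *\<^sub>R W"
  proof -
    have "((\<lambda>x. (G x \<bullet> G x) * exp (\<theta> x)) has_derivative
       (\<lambda>v. (G X \<bullet> G X) * (exp (\<theta> X) * (W \<bullet> v)) + (G X \<bullet> H X v + H X v \<bullet> G X) * exp (\<theta> X))) (at X)"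
      unfolding W_def
      by (intro has_derivative_mult has_derivative_inner G_deriv XS
          has_derivative_compose[OF T.u_deriv[OF XS] DERIV_exp[unfolded has_field_derivative_def]])
    from differential_zero_maxmin[OF Xb open_ball this] Pmax
    have "(\<lambda>v. (G X \<bullet> G X) * (exp (\<theta> X) * (W \<bullet> v)) + (G X \<bullet> H X v + H X v \<bullet> G X) * exp (\<theta> X)) = (\<lambda>v. 0)"
      by (auto simp: power2_norm_eq_inner)
    then have A: "(G X \<bullet> G X) * (exp (\<theta> X) * (W \<bullet> v)) + (G X \<bullet> H X v + H X v \<bullet> G X) * exp (\<theta> X) = 0" for v
      by meson
    have "exp (\<theta> X) * ((2 *\<^sub>R H X (G X) + (norm (G X))\<^sup>2 *\<^sub>R W) \<bullet> v) = 0" for v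
      using A[of v] H_sym[OF XS, of v "G X"] inner_commute[of "G X" "H X v"]
      by (simp add: inner_add_left power2_norm_eq_inner algebra_simps)
    then have "(2 *\<^sub>R H X (G X) + (norm (G X))\<^sup>2 *\<^sub>R W) \<bullet> v = 0" for v by simp
    then have "2 *\<^sub>R H X (G X) + (norm (G X))\<^sup>2 *\<^sub>R W = 0" using inner_eq_zero_iff by blast
    then show ?thesis by (simp add: eq_neg_iff_add_eq_0)
  qed

  \<comment> \<open>Passing to the limit in the discrete inequality\<close>
  define yi where "yi i n = y n + \<delta> n *\<^sub>R axis i 1" for i n
  have yi: "yi i \<longlonglongrightarrow> X" for i
    using tendsto_add[OF y tendsto_scaleR[OF \<delta> tendsto_const[of "axis i 1"]]] by (simp add: yi_def[abs_def])
  let ?S' = "{x \<in> S. G x \<noteq> 0}"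
  have XS': "X \<in> ?S'" using XS GX by simp
  let ?N = "\<lambda>x. sgn (G x)"
  let ?N' = "\<lambda>v. (H X v - (H X v \<bullet> N) *\<^sub>R N) /\<^sub>R norm (G X)"
  have Glim: "(\<lambda>n. G (z n)) \<longlonglongrightarrow> G X" "(\<lambda>n. ?N (z n)) \<longlonglongrightarrow> N" if "z \<longlonglongrightarrow> X" for z
  proof -
    show 1: "(\<lambda>n. G (z n)) \<longlonglongrightarrow> G X"
      by (rule continuous_on_tendsto_compose[OF G_cont that XS topological_tendstoD[OF that open_S XS]])
    show "(\<lambda>n. ?N (z n)) \<longlonglongrightarrow> N" unfolding N_def by (rule tendsto_sgn[OF 1 GX])
  qed
  define D where "D n i = (G (yi i n) - G (y n)) /\<^sub>R \<delta> n" for n i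
  define DN where "DN n i = (?N (yi i n) - ?N (y n)) /\<^sub>R \<delta> n" for n i
  define V where "V n i = (u (yi i n) - u (y n)) / \<delta> n" for n i
  define K where "K n i = (g (yi i n) - g (y n)) / \<delta> n
      - (p - 2) * (H (yi i n) (DN n i) \<bullet> ?N (yi i n) + H (yi i n) (?N (y n)) \<bullet> DN n i)" for n i
  have Dlim: "(\<lambda>n. D n i) \<longlonglongrightarrow> H X (axis i 1)" for i
    unfolding D_def yi_def by (rule difference_quotient_tendsto[OF open_S XS G_deriv H_cont y \<delta> \<delta>0(2)])
  have DNlim: "(\<lambda>n. DN n i) \<longlonglongrightarrow> ?N' (axis i 1)" for i
    unfolding DN_def yi_def N_def
    by (rule difference_quotient_tendsto[where f' = "\<lambda>x v. (H x v - (H x v \<bullet> sgn (G x)) *\<^sub>R sgn (G x)) /\<^sub>R norm (G x)",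
          OF open_noncritical XS' _ sgn_G_deriv_cont y \<delta> \<delta>0(2)]) (auto intro: sgn_G_deriv)
  have Vlim: "(\<lambda>n. V n i) \<longlonglongrightarrow> G X $ i" for i
    unfolding V_def yi_def by (rule wlim[OF y XS])
  have glim: "(\<lambda>n. (g (yi i n) - g (y n)) / \<delta> n) \<longlonglongrightarrow> g' X (axis i 1)" for i
  proof -
    have "(\<lambda>n. (g (yi i n) - g (y n)) /\<^sub>R \<delta> n) \<longlonglongrightarrow> g' X (axis i 1)"
      unfolding yi_def
      by (rule difference_quotient_tendsto[OF open_noncritical XS' _ g' y \<delta> \<delta>0(2)]) (auto intro: g)
    then show ?thesis by (simp add: divide_inverse mult.commute)
  qed
  have Klim: "(\<lambda>n. K n i) \<longlonglongrightarrow> g' X (axis i 1) - (p - 2) * (H X (?N' (axis i 1)) \<bullet> N + H X N \<bullet> ?N' (axis i 1))" for i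
    unfolding K_def
    by (intro tendsto_diff tendsto_mult tendsto_const tendsto_add tendsto_inner glim H_tendsto[OF XS]
        yi DNlim Glim y)
  have Wlim: "(\<lambda>n. T.G (y n)) \<longlonglongrightarrow> W"
    unfolding W_def by (rule continuous_on_tendsto_compose[OF T.G_cont y XS topological_tendstoD[OF y open_S XS]])
  have trlim: "(\<lambda>n. p_trace p (?N (y n)) (T.H (y n))) \<longlonglongrightarrow> p_trace p N (T.H X)"
    unfolding p_trace_def
    by (intro tendsto_intros T.H_tendsto[OF XS] y Glim)
  have ineq: "\<forall>\<^sub>F n in sequentially. 2 * (\<Sum>i\<in>UNIV. (norm (D n i))\<^sup>2 + (p - 2) * (D n i \<bullet> ?N (y n))\<^sup>2)
      + 2 * (\<Sum>i\<in>UNIV. V n i * K n i) \<le> (\<Sum>i\<in>UNIV. (V n i)\<^sup>2) * ((norm (T.G (y n)))\<^sup>2 + (p - 2) * (T.G (y n) \<bullet> ?N (y n))\<^sup>2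
        - p_trace p (?N (y n)) (T.H (y n)))"
  proof -
    have "\<forall>\<^sub>F n in sequentially. y n \<in> ball c r" by (rule topological_tendstoD[OF y open_ball Xb])
    moreover have "\<forall>\<^sub>F n in sequentially. y n \<in> ?S'" by (rule topological_tendstoD[OF y open_noncritical XS'])
    moreover have "\<forall>\<^sub>F n in sequentially. \<forall>i\<in>UNIV. yi i n \<in> ?S'"
      by (rule eventually_ball_finite) (use topological_tendstoD[OF yi open_noncritical XS'] in auto)
    ultimately show ?thesis
    proof eventually_elim
      case (elim n)
      obtain d0 where d0: "d0 > 0" "ball (y n) d0 \<subseteq> ball c r" using elim(1) open_ball openE by blast
      define d where "d = min d0 (\<rho> / 2)"
      have d: "d > 0" "ball (y n) d \<subseteq> cball c r" "d \<le> \<rho> / 2"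
        using d0 \<rho>0 by (auto simp: d_def)
      have k: "(p_trace p (?N (y n)) (H (yi i n)) - p_trace p (?N (y n)) (H (y n))) / \<delta> n = K n i" for i
      proof -
        have l: "linear (H (yi i n))" using elim(3) H_linear by blast
        have "p_trace p (?N (yi i n)) (H (yi i n)) = g (yi i n)" using elim(3) eq by blast
        moreover have "p_trace p (?N (y n)) (H (y n)) = g (y n)" using elim(2) eq by blast
        moreover have "p_trace p (?N (y n)) (H (yi i n)) = p_trace p (?N (yi i n)) (H (yi i n))
            - (p - 2) * (H (yi i n) (?N (yi i n) - ?N (y n)) \<bullet> ?N (yi i n) + H (yi i n) (?N (y n)) \<bullet> (?N (yi i n) - ?N (y n)))"
          by (simp add: p_trace_def linear_diff[OF l] inner_diff_left inner_diff_right algebra_simps)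
        moreover have "H (yi i n) (?N (yi i n) - ?N (y n)) = \<delta> n *\<^sub>R H (yi i n) (DN n i)"
          using \<delta>0(2)[of n] by (simp add: DN_def flip: linear_scale[OF l])
        moreover have "?N (yi i n) - ?N (y n) = \<delta> n *\<^sub>R DN n i"
          using \<delta>0(2)[of n] by (simp add: DN_def)
        ultimately show ?thesis using \<delta>0(2)[of n] by (simp add: K_def field_simps)
      qed
      have 1: "ball (y n) d \<subseteq> S" using d(2) cball by blast
      have 2: "ball (y n + \<delta> n *\<^sub>R axis i 1) d \<subseteq> S" for i
        using sh[OF yc[of n], of "\<phi> n" i] subset_ball[OF d(3)] unfolding \<delta>_def by blast
      have 3: "(\<Sum>i\<in>UNIV. ((u (x + \<delta> n *\<^sub>R axis i 1) - u x) / \<delta> n)\<^sup>2) * exp (\<theta> x)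
        \<le> (\<Sum>i\<in>UNIV. ((u (y n + \<delta> n *\<^sub>R axis i 1) - u (y n)) / \<delta> n)\<^sup>2) * exp (\<theta> (y n))" if "x \<in> ball (y n) d" for x
        using Y(2)[of x "\<phi> n"] that d(2) by (auto simp: \<delta>_def y_def)
      have "norm (?N (y n)) = 1" using elim(2) by (simp add: norm_sgn)
      from discrete_bernstein[OF \<theta> p this d(1) 1 2 3]
      show ?case unfolding yi_def[symmetric] k D_def[symmetric] V_def[symmetric] .
    qed
  qed
  have lim1: "(\<lambda>n. 2 * (\<Sum>i\<in>UNIV. (norm (D n i))\<^sup>2 + (p - 2) * (D n i \<bullet> ?N (y n))\<^sup>2) + 2 * (\<Sum>i\<in>UNIV. V n i * K n i))
    \<longlonglongrightarrow> 2 * (\<Sum>i\<in>UNIV. (norm (H X (axis i 1)))\<^sup>2 + (p - 2) * (H X (axis i 1) \<bullet> N)\<^sup>2)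
      + 2 * (\<Sum>i\<in>UNIV. G X $ i * (g' X (axis i 1) - (p - 2) * (H X (?N' (axis i 1)) \<bullet> N + H X N \<bullet> ?N' (axis i 1))))"
    by (intro tendsto_add tendsto_mult tendsto_const tendsto_sum tendsto_power tendsto_norm tendsto_inner Dlim Vlim Klim Glim y)
  have lim2: "(\<lambda>n. (\<Sum>i\<in>UNIV. (V n i)\<^sup>2) * ((norm (T.G (y n)))\<^sup>2 + (p - 2) * (T.G (y n) \<bullet> ?N (y n))\<^sup>2
        - p_trace p (?N (y n)) (T.H (y n))))
    \<longlonglongrightarrow> (\<Sum>i\<in>UNIV. (G X $ i)\<^sup>2) * ((norm W)\<^sup>2 + (p - 2) * (W \<bullet> N)\<^sup>2 - p_trace p N (T.H X))"
    by (intro tendsto_add tendsto_diff tendsto_mult tendsto_const tendsto_sum tendsto_power tendsto_norm tendsto_inner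
        Vlim Wlim trlim Glim y)
  have main: "2 * (\<Sum>i\<in>UNIV. (norm (H X (axis i 1)))\<^sup>2 + (p - 2) * (H X (axis i 1) \<bullet> N)\<^sup>2)
      + 2 * (\<Sum>i\<in>UNIV. G X $ i * (g' X (axis i 1) - (p - 2) * (H X (?N' (axis i 1)) \<bullet> N + H X N \<bullet> ?N' (axis i 1))))
    \<le> (\<Sum>i\<in>UNIV. (G X $ i)\<^sup>2) * ((norm W)\<^sup>2 + (p - 2) * (W \<bullet> N)\<^sup>2 - p_trace p N (T.H X))"
    using tendsto_le[OF _ lim2 lim1 ineq] by simp

  \<comment> \<open>Simplifying the limit inequality\<close>
  define \<nu> where "\<nu> = norm (G X)"
  have \<nu>: "\<nu> > 0" using GX by (simp add: \<nu>_def)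
  have GN: "G X = \<nu> *\<^sub>R N" using \<nu> by (simp add: N_def \<nu>_def sgn_div_norm)
  note lin = H_linear[OF XS]
  define h where "h = H X N"
  have HGh: "H X (G X) = \<nu> *\<^sub>R h" unfolding GN h_def by (rule linear_scale[OF lin])
  have hW: "h = (- \<nu> / 2) *\<^sub>R W"
  proof -
    have "(2 * \<nu>) *\<^sub>R h = (2 * \<nu>) *\<^sub>R ((- \<nu> / 2) *\<^sub>R W)"
      using HG by (simp add: HGh \<nu>_def[symmetric] power2_eq_square)
    then show ?thesis using \<nu> by (simp only: scaleR_cancel_left) simp
  qed
  have a1: "(\<Sum>i\<in>UNIV. (G X $ i)\<^sup>2) = \<nu>\<^sup>2"
    by (simp add: \<nu>_def norm_vec_def L2_set_def sum_nonneg)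
  have a2: "(\<Sum>i\<in>UNIV. (H X (axis i 1) \<bullet> N)\<^sup>2) = (norm h)\<^sup>2"
  proof -
    have "H X (axis i 1) \<bullet> N = h $ i" for i
      using H_sym[OF XS, of "axis i 1" N] by (simp add: h_def inner_axis)
    then show ?thesis by (simp add: norm_vec_def L2_set_def sum_nonneg)
  qed
  have "linear (g' X)" using g[OF XS GX] has_derivative_linear by blast
  then have a3: "(\<Sum>i\<in>UNIV. G X $ i * g' X (axis i 1)) = g' X (G X)"
    using linear_sum_axis[of "g' X" "G X"] by simp
  have linN': "linear ?N'"
    by (intro linearI) (simp_all add: linear_add[OF lin] linear_scale[OF lin] inner_add_left scaleR_diff_right algebra_simps)
  \<comment> \<open>Both summands equal the inner product of \<open>?N' v\<close> with
    \<open>h\<close> because the Hessian is symmetric. For v = \<open>G X\<close> the vector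
    \<open>?N' v\<close> is the part of \<open>h\<close> orthogonal to \<open>N\<close>.\<close>
  have a4: "(\<Sum>i\<in>UNIV. G X $ i * (H X (?N' (axis i 1)) \<bullet> N + H X N \<bullet> ?N' (axis i 1))) = 2 * ((norm h)\<^sup>2 - (h \<bullet> N)\<^sup>2)"
  proof -
    have "H X (?N' v) \<bullet> N + H X N \<bullet> ?N' v = 2 * (?N' v \<bullet> h)" for v
      using H_sym[OF XS, of "?N' v" N] by (simp add: h_def inner_commute)
    then have "(\<Sum>i\<in>UNIV. G X $ i * (H X (?N' (axis i 1)) \<bullet> N + H X N \<bullet> ?N' (axis i 1)))
       = (\<Sum>i\<in>UNIV. G X $ i * (2 * (?N' (axis i 1) \<bullet> h)))" by presburger
    also have "\<dots> = 2 * ((\<Sum>i\<in>UNIV. (G X $ i) *\<^sub>R ?N' (axis i 1)) \<bullet> h)"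
      by (simp only: inner_sum_left sum_distrib_left inner_scaleR_left mult.left_commute)
    also have "\<dots> = 2 * (?N' (G X) \<bullet> h)" using linear_sum_axis[OF linN', of "G X"] by presburger
    also have "?N' (G X) = h - (h \<bullet> N) *\<^sub>R N"
      using \<nu> by (simp add: HGh \<nu>_def[symmetric] scaleR_diff_right)
    also have "(h - (h \<bullet> N) *\<^sub>R N) \<bullet> h = (norm h)\<^sup>2 - (h \<bullet> N)\<^sup>2"
      unfolding inner_diff_left power2_norm_eq_inner by (simp add: power2_eq_square inner_commute[of N h])
    finally show ?thesis .
  qed
  have n1: "(norm h)\<^sup>2 = \<nu>\<^sup>2 / 4 * (norm W)\<^sup>2" "(h \<bullet> N)\<^sup>2 = \<nu>\<^sup>2 / 4 * (W \<bullet> N)\<^sup>2"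
    by (simp_all add: hW power_mult_distrib power_divide)
  have sum_diff: "(\<Sum>i\<in>UNIV. a i * (b i - (p - 2) * d i))
      = (\<Sum>i\<in>UNIV. a i * b i) - (p - 2) * (\<Sum>i\<in>UNIV. a i * d i)" for a b d :: "'n \<Rightarrow> real"
    by (simp add: right_diff_distrib sum_subtractf sum_distrib_left mult.left_commute)
  have "(\<Sum>i\<in>UNIV. G X $ i * (g' X (axis i 1) - (p - 2) * (H X (?N' (axis i 1)) \<bullet> N + H X N \<bullet> ?N' (axis i 1))))
     = g' X (G X) - (p - 2) * (2 * ((norm h)\<^sup>2 - (h \<bullet> N)\<^sup>2))"
    unfolding sum_diff a3 a4 ..
  from main[unfolded this a1 sum.distrib sum_distrib_left[symmetric] a2 n1]
  \<comment> \<open>After \<open>n1\<close> replaces \<open>h\<close> by \<open>W\<close>, the terms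
    in (W . N)^2 cancel, and the coefficient of |W|^2 is 1/2 + (p - 2)/4 = p/4.\<close>
  have "(\<Sum>i\<in>UNIV. (norm (H X (axis i 1)))\<^sup>2) + g' X (G X) \<le> \<nu>\<^sup>2 *
      (p / 4 * (norm W)\<^sup>2 - p_trace p N (T.H X) / 2)"
    by (simp add: field_simps)
  then show ?thesis
    using that[OF Xb GX Pmax] HG unfolding W_def \<nu>_def N_def by blast
qed

end

section \<open>The equation in nondivergence form\<close>

lemma young: "a * b \<le> a\<^sup>2 / (4 * e) + e * (b::real)\<^sup>2" if "e > 0"
proof -
  have "0 \<le> (a - 2 * e * b)\<^sup>2" by simp
  then have "4 * e * (a * b) \<le> a\<^sup>2 + 4 * e\<^sup>2 * b\<^sup>2" by (simp add: power2_eq_square algebra_simps)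
  then show ?thesis using that by (simp add: field_simps power2_eq_square)
qed

text \<open>The quantities at a maximum of the Bernstein function, made dimensionless with \<open>r\<close>: in terms of
  \<open>\<nu> = |\<nabla>u|\<close>, the absorption term \<open>f\<close> already divided by \<open>|x|\<^sup>\<sigma>\<nu>\<^bsup>p-2\<^esup>\<close>, and the exponent
  \<open>\<theta> = \<Psi>(u) - B|x - c|\<^sup>2/r\<^sup>2\<close>, they are \<open>\<phi> = rf/\<nu>\<close>, \<open>S = r\<^sup>2|D\<^sup>2u|\<^sup>2/\<nu>\<^sup>2\<close>, \<open>w = r|\<nabla>\<theta>|\<close>, \<open>\<omega> = -r\<Psi>'(u)\<nu>\<close> and
  \<open>T = r\<^sup>2\<Psi>''(u)\<nu>\<^sup>2\<close>. What matters below is that \<open>\<kappa>\<close> can be chosen before \<open>B\<close>.\<close>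

definition bernstein_system ::
  "real \<Rightarrow> real \<Rightarrow> real \<Rightarrow> real \<Rightarrow> real \<Rightarrow> real \<Rightarrow> real \<Rightarrow> real \<Rightarrow> real \<Rightarrow> real \<Rightarrow> real \<Rightarrow> real \<Rightarrow> bool" where
  "bernstein_system n p s \<mu> \<sigma> \<kappa> B \<phi> S w \<omega> T \<longleftrightarrow>
    0 \<le> \<phi> \<and> 0 \<le> w \<and> 0 \<le> \<omega> \<and> w \<le> 2 * B + \<omega> \<and> 0 \<le> T \<and> \<omega>\<^sup>2 \<le> \<kappa> / 2 * T \<and>
    \<phi>\<^sup>2 \<le> 4 * n * S + (p - 2)\<^sup>2 * w\<^sup>2 + 2 * \<sigma>\<^sup>2 \<and>
    S - \<phi> * (\<bar>s\<bar> + \<bar>\<mu>\<bar> * w / 2) - \<bar>\<sigma>\<bar> * (w / 2 + 3)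
      \<le> p / 4 * w\<^sup>2 + B * (n + p - 2) - T * (p - 1) / 2 + \<omega> * (\<phi> + \<bar>\<sigma>\<bar>) / 2"

text \<open>Young's inequality absorbs every term linear in \<phi> into \<phi>^2, which
  \<open>S\<close> controls. What remains is a multiple of \<omega>^2 plus a constant; since
  \<omega>^2 is at most \<kappa>/2 times \<open>T\<close>, the good term in \<open>T\<close>
  swallows it for small \<kappa>. The multiple \<open>C1\<close> is free of \<open>B\<close>, which
  enters only the constant, so \<kappa> comes first.\<close>

lemma absorption:
  fixes n p s \<mu> \<sigma> :: real
  assumes n: "n \<ge> 1" and p: "p > 1"
  shows "\<exists>\<kappa>>0. \<forall>B\<ge>0. \<exists>K>0. \<forall>\<phi> S w \<omega> T.
    bernstein_system n p s \<mu> \<sigma> \<kappa> B \<phi> S w \<omega> T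
    \<longrightarrow> \<phi>\<^sup>2 \<le> K \<and> T \<le> K"
proof -
  define c where "c = p / 4 + (p - 2)\<^sup>2 + 2 * n * \<mu>\<^sup>2 + 1"
  define C1 where "C1 = 2 * c + 2 * n + 1"
  have "c > 0" using n p unfolding c_def by (intro add_nonneg_pos add_nonneg_nonneg) auto
  then have C1: "C1 > 0" using n by (simp add: C1_def)
  \<comment> \<open>This makes \<open>C1 * \<omega>\<^sup>2\<close> at most half of the good term
    \<open>T * (p - 1) / 2\<close>.\<close>
  define \<kappa> where "\<kappa> = (p - 1) / (2 * C1)"
  have \<kappa>: "\<kappa> > 0" using p C1 by (simp add: \<kappa>_def)
  show ?thesis
  proof (rule exI[of _ \<kappa>], intro conjI[OF \<kappa>] allI impI)
    fix B :: real assume B: "B \<ge> 0"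
    define C2 where "C2 = 8 * B\<^sup>2 * c + 6 * n * s\<^sup>2 + 3 * \<sigma>\<^sup>2 + 3 * \<bar>\<sigma>\<bar> + B * (n + p - 2)"
    have C2: "C2 \<ge> 0" using B n p \<open>c > 0\<close> unfolding C2_def by (intro add_nonneg_nonneg) auto
    define K where "K = C2 * (8 * n) + C2 * 4 / (p - 1) + 1"
    have K: "K > 0" using C2 n p unfolding K_def by (intro add_nonneg_pos add_nonneg_nonneg) auto
    show "\<exists>K>0. \<forall>\<phi> S w \<omega> T.
    bernstein_system n p s \<mu> \<sigma> \<kappa> B \<phi> S w \<omega> T
    \<longrightarrow> \<phi>\<^sup>2 \<le> K \<and> T \<le> K"
    proof (rule exI[of _ K], intro conjI[OF K] allI impI)
      fix \<phi> S w \<omega> T :: real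
      assume "bernstein_system n p s \<mu> \<sigma> \<kappa> B \<phi> S w \<omega> T"
      then have pos: "0 \<le> \<phi>" "0 \<le> w" "0 \<le> \<omega>" "w \<le> 2 * B + \<omega>" "0 \<le> T"
        and om: "\<omega>\<^sup>2 \<le> \<kappa> / 2 * T"
        and S: "\<phi>\<^sup>2 \<le> 4 * n * S + (p - 2)\<^sup>2 * w\<^sup>2 + 2 * \<sigma>\<^sup>2"
        and main: "S - \<phi> * (\<bar>s\<bar> + \<bar>\<mu>\<bar> * w / 2) - \<bar>\<sigma>\<bar> * (w / 2 + 3)
          \<le> p / 4 * w\<^sup>2 + B * (n + p - 2) - T * (p - 1) / 2 + \<omega> * (\<phi> + \<bar>\<sigma>\<bar>) / 2"
        unfolding bernstein_system_def by simp_all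
      \<comment> \<open>Up to terms in w^2 and \<sigma>^2, \<open>S\<close> is at least
        \<open>6 * F\<close>; each of the three applications of Young's inequality in
        \<open>y1\<close>, \<open>y2\<close> and \<open>y3\<close> costs one \<open>F\<close>, so
        three are left.\<close>
      define F where "F = \<phi>\<^sup>2 / (24 * n)"
      have y1: "\<phi> * \<bar>s\<bar> \<le> F + 6 * n * s\<^sup>2"
        using young[of "6 * n" \<phi> "\<bar>s\<bar>"] n by (simp add: F_def)
      have y2: "\<phi> * (\<bar>\<mu>\<bar> * w / 2) \<le> F + 2 * n * \<mu>\<^sup>2 * w\<^sup>2"
      proof -
        have "\<phi> * (\<bar>\<mu>\<bar> * w / 2) \<le> F + 6 * n * (\<bar>\<mu>\<bar> * w / 2)\<^sup>2"
          using young[of "6 * n" \<phi> "\<bar>\<mu>\<bar> * w / 2"] n by (simp add: F_def)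
        also have "6 * n * (\<bar>\<mu>\<bar> * w / 2)\<^sup>2 = 3 / 2 * (n * \<mu>\<^sup>2 * w\<^sup>2)"
          by (simp add: power_divide power_mult_distrib)
        also have "\<dots> \<le> 2 * (n * \<mu>\<^sup>2 * w\<^sup>2)" using n by (intro mult_right_mono) auto
        finally show ?thesis by (simp add: mult.assoc)
      qed
      have y3: "\<omega> * \<phi> / 2 \<le> F + 2 * n * \<omega>\<^sup>2"
      proof -
        have "\<phi> * (\<omega> / 2) \<le> F + 6 * n * (\<omega> / 2)\<^sup>2"
          using young[of "6 * n" \<phi> "\<omega> / 2"] n by (simp add: F_def)
        also have "6 * n * (\<omega> / 2)\<^sup>2 = 3 / 2 * (n * \<omega>\<^sup>2)"
          by (simp add: power_divide)
        also have "\<dots> \<le> 2 * (n * \<omega>\<^sup>2)" using n by (intro mult_right_mono) auto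
        finally show ?thesis by (simp add: mult.commute mult.left_commute)
      qed
      have y4: "\<bar>\<sigma>\<bar> * w / 2 \<le> \<sigma>\<^sup>2 + w\<^sup>2" "\<bar>\<sigma>\<bar> * \<omega> / 2 \<le> \<sigma>\<^sup>2 + \<omega>\<^sup>2"
        using young[of 1 "\<bar>\<sigma>\<bar>" w, unfolded power2_abs] young[of 1 "\<bar>\<sigma>\<bar>" \<omega>, unfolded power2_abs]
          zero_le_power2[of \<sigma>] zero_le_power2[of w] zero_le_power2[of \<omega>] by linarith+
      have y5: "w\<^sup>2 \<le> 8 * B\<^sup>2 + 2 * \<omega>\<^sup>2"
      proof -
        have "w\<^sup>2 \<le> (2 * B + \<omega>)\<^sup>2" using pos by (intro power_mono) auto
        also have "\<dots> \<le> 8 * B\<^sup>2 + 2 * \<omega>\<^sup>2"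
          using zero_le_power2[of "2 * B - \<omega>"] by (simp add: power2_eq_square algebra_simps)
        finally show ?thesis .
      qed
      have "\<phi>\<^sup>2 / (4 * n) \<le> S + ((p - 2)\<^sup>2 * w\<^sup>2 + 2 * \<sigma>\<^sup>2) / (4 * n)"
        using S n by (simp add: field_simps)
      also have "((p - 2)\<^sup>2 * w\<^sup>2 + 2 * \<sigma>\<^sup>2) / (4 * n) \<le> ((p - 2)\<^sup>2 * w\<^sup>2 + 2 * \<sigma>\<^sup>2) / 2"
        using n by (intro divide_left_mono) auto
      also have "\<dots> \<le> (p - 2)\<^sup>2 * w\<^sup>2 + \<sigma>\<^sup>2" by simp
      finally have "6 * F \<le> S + ((p - 2)\<^sup>2 * w\<^sup>2 + \<sigma>\<^sup>2)" by (simp add: F_def)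
      then have "3 * F + T * (p - 1) / 2 \<le> c * w\<^sup>2 + (2 * n + 1) * \<omega>\<^sup>2 + 6 * n * s\<^sup>2 + 3 * \<sigma>\<^sup>2 + 3 * \<bar>\<sigma>\<bar> + B * (n + p - 2)"
        using main y1 y2 y3 y4 unfolding c_def by (simp add: algebra_simps add_divide_distrib)
      also have "c * w\<^sup>2 \<le> c * (8 * B\<^sup>2 + 2 * \<omega>\<^sup>2)" using y5 \<open>c > 0\<close> by (intro mult_left_mono) auto
      finally have "3 * F + T * (p - 1) / 2 \<le> C1 * \<omega>\<^sup>2 + C2"
        by (simp add: C1_def C2_def algebra_simps)
      also have "C1 * \<omega>\<^sup>2 \<le> C1 * (\<kappa> / 2 * T)" using om C1 by (intro mult_left_mono) auto
      also have "\<dots> = T * (p - 1) / 4" using C1 by (simp add: \<kappa>_def field_simps)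
      finally have fin: "3 * F + T * (p - 1) / 4 \<le> C2" by simp
      have "F \<ge> 0" "T * (p - 1) / 4 \<ge> 0" using n pos p by (auto simp: F_def)
      then have "3 * F \<le> C2" "T * (p - 1) / 4 \<le> C2" using fin by auto
      then have "\<phi>\<^sup>2 \<le> C2 * (8 * n)" "T \<le> C2 * 4 / (p - 1)" using n p by (auto simp: F_def field_simps)
      moreover have "C2 * (8 * n) \<ge> 0" "C2 * 4 / (p - 1) \<ge> 0" using C2 n p by auto
      ultimately show "\<phi>\<^sup>2 \<le> K \<and> T \<le> K" by (auto simp: K_def)
    qed
  qed
qed

context C2_fun
begin

lemma norm_G_deriv: "x \<in> S \<Longrightarrow> G x \<noteq> 0 \<Longrightarrow> ((\<lambda>x. norm (G x)) has_derivative (\<lambda>v. H x v \<bullet> sgn (G x))) (at x)"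
  by (rule has_derivative_compose[OF G_deriv has_derivative_norm])

text \<open>Cauchy-Schwarz on the trace. Since the equation equates \<open>p_trace\<close> with the
  lower-order terms, this is how the squared Hessian comes to dominate the square of the absorption
  term.\<close>

lemma p_trace_square_le:
  assumes "x \<in> S"
  shows "(p_trace p w (H x))\<^sup>2 \<le> 2 * real CARD('n) * (\<Sum>i\<in>UNIV. (norm (H x (axis i 1)))\<^sup>2) + 2 * (p - 2)\<^sup>2 * (H x w \<bullet> w)\<^sup>2"
proof -
  have "(\<Sum>i\<in>UNIV. H x (axis i 1) $ i)\<^sup>2 \<le> (\<Sum>i\<in>UNIV. (H x (axis i 1) $ i)\<^sup>2) * (\<Sum>i\<in>(UNIV::'n set). 1\<^sup>2)"
    using Cauchy_Schwarz_ineq_sum[of "\<lambda>i. H x (axis i 1) $ i" "\<lambda>_. 1" UNIV] by simp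
  also have "\<dots> \<le> (\<Sum>i\<in>UNIV. (norm (H x (axis i 1)))\<^sup>2) * (\<Sum>i\<in>(UNIV::'n set). 1\<^sup>2)"
    by (intro mult_right_mono sum_mono) (auto simp: component_le_norm_cart abs_le_square_iff[symmetric])
  finally have 1: "(\<Sum>i\<in>UNIV. H x (axis i 1) $ i)\<^sup>2 \<le> real CARD('n) * (\<Sum>i\<in>UNIV. (norm (H x (axis i 1)))\<^sup>2)"
    by (simp add: mult.commute)
  have "(a + b)\<^sup>2 \<le> 2 * a\<^sup>2 + 2 * b\<^sup>2" for a b :: real
    using zero_le_power2[of "a - b"] by (simp add: power2_eq_square algebra_simps)
  from this[of "\<Sum>i\<in>UNIV. H x (axis i 1) $ i" "(p - 2) * (H x w \<bullet> w)"] 1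
  show ?thesis by (simp add: p_trace_def power_mult_distrib)
qed

text \<open>Off the critical set the flux is differentiable. The partial derivatives, known from
  \<open>has_divergence\<close> only to exist, are therefore those of the product rule; the
  derivative of |x|^\<sigma> contributes the drift term.\<close>

lemma divergence_flux:
  assumes x: "x \<in> S" "x \<noteq> 0" "G x \<noteq> 0" and d: "has_divergence (flux p \<sigma> u) d x"
  shows "d = norm x powr \<sigma> * norm (G x) powr (p - 2) *
    (p_trace p (sgn (G x)) (H x) + \<sigma> * (G x \<bullet> x) / (norm x)\<^sup>2)"
proof -
  define a where "a = norm x powr \<sigma>"
  define b where "b = norm (G x) powr (p - 2)"
  obtain D where D: "\<And>i. ((\<lambda>t. flux p \<sigma> u (x + t *\<^sub>R axis i 1) $ i) has_real_derivative D i) (at 0)"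
    "d = (\<Sum>i\<in>UNIV. D i)" using d unfolding has_divergence_def by auto
  have line: "((\<lambda>t. F (x + t *\<^sub>R v)) has_real_derivative F' v) (at 0)"
    if "(F has_derivative F') (at x)" for F F' and v :: "real^'n"
  proof -
    have "((\<lambda>t. F (x + t *\<^sub>R v)) has_derivative (\<lambda>t. F' (t *\<^sub>R v))) (at 0)"
      by (rule has_derivative_compose[where f = "\<lambda>t. x + t *\<^sub>R v"])
         (use that in \<open>auto intro!: derivative_eq_intros\<close>)
    then show ?thesis
      unfolding has_field_derivative_def
      by (rule has_derivative_eq_rhs) (simp add: fun_eq_iff linear_scale[OF has_derivative_linear[OF that]])
  qed
  have pw: "((\<lambda>t. F t powr r) has_real_derivative r * (F 0 powr r / F 0) * F') (at 0)"
    if "(F has_real_derivative F') (at 0)" "F 0 > 0" for F F' r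
    using DERIV_chain2[OF has_real_derivative_powr[OF that(2)] that(1), of r] that(2)
    by (simp add: powr_diff)
  have "D i = (a * ((p - 2) * (b / norm (G x)) * (H x (axis i 1) \<bullet> sgn (G x))) + \<sigma> * (a / norm x) * (axis i 1 \<bullet> sgn x) * b) * G x $ i
      + H x (axis i 1) $ i * (a * b)" for i
  proof (rule DERIV_unique[OF D(1)])
    have 1: "((\<lambda>t. norm (x + t *\<^sub>R axis i 1) powr \<sigma>) has_real_derivative \<sigma> * (a / norm x) * (axis i 1 \<bullet> sgn x)) (at 0)"
      using pw[OF line[OF has_derivative_norm[OF x(2)]]] x(2) by (simp add: a_def)
    have 2: "((\<lambda>t. norm (G (x + t *\<^sub>R axis i 1)) powr (p - 2)) has_real_derivative
        (p - 2) * (b / norm (G x)) * (H x (axis i 1) \<bullet> sgn (G x))) (at 0)"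
      using pw[OF line[OF norm_G_deriv[OF x(1,3)]]] x(3) by (simp add: b_def)
    have 3: "((\<lambda>t. G (x + t *\<^sub>R axis i 1) $ i) has_real_derivative H x (axis i 1) $ i) (at 0)"
      using G_line[of x 0 "axis i 1" "axis i 1"] x(1) by (simp add: inner_axis)
    show "((\<lambda>t. flux p \<sigma> u (x + t *\<^sub>R axis i 1) $ i) has_real_derivative
      (a * ((p - 2) * (b / norm (G x)) * (H x (axis i 1) \<bullet> sgn (G x))) + \<sigma> * (a / norm x) * (axis i 1 \<bullet> sgn x) * b) * G x $ i
      + H x (axis i 1) $ i * (a * b)) (at 0)"
      unfolding flux_def vector_scaleR_component
      using DERIV_mult[OF DERIV_mult[OF 1 2] 3] by (simp add: a_def b_def algebra_simps)
  qed
  then have D': "D i = a * b * ((p - 2) / norm (G x) * (G x $ i * (H x (axis i 1) \<bullet> sgn (G x)))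
      + \<sigma> / norm x * (G x $ i * sgn x $ i) + H x (axis i 1) $ i)" for i
    by (simp add: inner_axis' algebra_simps)
  have s1: "(\<Sum>i\<in>UNIV. G x $ i * (H x (axis i 1) \<bullet> sgn (G x))) = H x (G x) \<bullet> sgn (G x)"
    using linear_sum_axis[OF H_linear[OF x(1)], of "G x"] by (simp add: inner_sum_left)
  have s2: "(\<Sum>i\<in>UNIV. G x $ i * sgn x $ i) = G x \<bullet> sgn x" by (simp add: inner_vec_def)
  have "d = a * b * ((p - 2) / norm (G x) * (H x (G x) \<bullet> sgn (G x)) + \<sigma> / norm x * (G x \<bullet> sgn x)
      + (\<Sum>i\<in>UNIV. H x (axis i 1) $ i))"
    unfolding D(2) D' by (simp only: sum.distrib sum_distrib_left[symmetric] s1 s2)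
  also have "H x (G x) = norm (G x) *\<^sub>R H x (sgn (G x))"
    using x(3) by (simp add: sgn_div_norm flip: linear_scale[OF H_linear[OF x(1)]])
  also have "(p - 2) / norm (G x) * ((norm (G x) *\<^sub>R H x (sgn (G x))) \<bullet> sgn (G x)) = (p - 2) * (H x (sgn (G x)) \<bullet> sgn (G x))"
    using x(3) by simp
  also have "\<sigma> / norm x * (G x \<bullet> sgn x) = \<sigma> * (G x \<bullet> x) / (norm x)\<^sup>2"
    by (simp add: sgn_div_norm power2_eq_square divide_inverse)
  finally show ?thesis by (simp add: a_def b_def p_trace_def add_ac)
qed

end

section \<open>The reduced right-hand side and its derivative\<close>

lemma has_derivative_powr_const:
  fixes f :: "'a::real_normed_vector \<Rightarrow> real"
  assumes f: "(f has_derivative f') (at x)" and pos: "f x > 0"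
  shows "((\<lambda>y. f y powr r) has_derivative (\<lambda>v. f x powr r * (r * f' v / f x))) (at x)"
  by (rule has_derivative_eq_rhs, rule has_derivative_compose[OF f],
      rule has_real_derivative_powr[OF pos, unfolded has_field_derivative_def])
     (use pos in \<open>simp add: fun_eq_iff powr_diff\<close>)

context C2_fun
begin

text \<open>With s = \<sigma> + \<tau> and e = m - p + 2 this is the absorption term divided by
  |x|^\<sigma> |grad u|^(p-2).\<close>

definition "weight s q e x = norm x powr (- s) * u x powr q * norm (G x) powr e"

definition "weight' s q e x v =
  weight s q e x * (- s * (v \<bullet> x) / (x \<bullet> x) + q * (G x \<bullet> v) / u x + e * (H x v \<bullet> G x) / (G x \<bullet> G x))"

text \<open>The value that the equation assigns to the normalised p-Laplacian: the drift caused by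
  |x|^\<sigma> has been moved to the right.\<close>

definition "reduced_rhs \<sigma> s q e x = weight s q e x - \<sigma> * (G x \<bullet> x) / (x \<bullet> x)"

definition "reduced_rhs' \<sigma> s q e x v = weight' s q e x v
    - \<sigma> * ((G x \<bullet> v + H x v \<bullet> x) / (x \<bullet> x) - (G x \<bullet> x) * (2 * (v \<bullet> x)) / (x \<bullet> x)\<^sup>2)"

lemma weight_deriv:
  assumes x: "x \<in> S" "x \<noteq> 0" "u x > 0" "G x \<noteq> 0"
  shows "(weight s q e has_derivative weight' s q e x) (at x)"
proof -
  have n: "a / norm y * (v \<bullet> sgn y) = a * (v \<bullet> y) / (y \<bullet> y)" for a and y v :: "real^'n"
    by (simp add: sgn_div_norm power2_norm_eq_inner[symmetric] power2_eq_square divide_inverse)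
  have "norm x > 0" "norm (G x) > 0" using x by auto
  from has_derivative_mult[OF has_derivative_mult[OF
      has_derivative_powr_const[OF has_derivative_norm[OF x(2)] this(1), of "- s"]
      has_derivative_powr_const[OF u_deriv[OF x(1)] x(3), of q]]
      has_derivative_powr_const[OF norm_G_deriv[OF x(1,4)] this(2), of e]]
  show ?thesis
    unfolding weight_def[abs_def]
    by (rule has_derivative_eq_rhs)
       (simp add: fun_eq_iff weight'_def weight_def n[symmetric] algebra_simps)
qed

lemma reduced_rhs_deriv:
  assumes x: "x \<in> S" "x \<noteq> 0" "u x > 0" "G x \<noteq> 0"
  shows "(reduced_rhs \<sigma> s q e has_derivative reduced_rhs' \<sigma> s q e x) (at x)"
proof -
  have 1: "((\<lambda>x. G x \<bullet> x) has_derivative (\<lambda>v. G x \<bullet> v + H x v \<bullet> x)) (at x)"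
    by (intro has_derivative_inner G_deriv x has_derivative_ident)
  have 2: "((\<lambda>x. x \<bullet> x) has_derivative (\<lambda>v. x \<bullet> v + v \<bullet> x)) (at x)"
    by (intro has_derivative_inner has_derivative_ident)
  have "((\<lambda>x. (G x \<bullet> x) / (x \<bullet> x)) has_derivative
    (\<lambda>v. ((G x \<bullet> v + H x v \<bullet> x) * (x \<bullet> x) - (G x \<bullet> x) * (x \<bullet> v + v \<bullet> x)) / ((x \<bullet> x) * (x \<bullet> x)))) (at x)"
    using has_derivative_divide'[OF 1 2] x(2) by simp
  moreover have "(A * X - B * (x \<bullet> v + v \<bullet> x)) / (X * X) = A / X - B * (2 * (v \<bullet> x)) / X\<^sup>2"
    if "X \<noteq> 0" for A B X :: real and v
    unfolding inner_commute[of x v] using that by (simp add: field_simps power2_eq_square)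
  ultimately have "((\<lambda>x. (G x \<bullet> x) / (x \<bullet> x)) has_derivative
    (\<lambda>v. (G x \<bullet> v + H x v \<bullet> x) / (x \<bullet> x) - (G x \<bullet> x) * (2 * (v \<bullet> x)) / (x \<bullet> x)\<^sup>2)) (at x)"
    using x(2) by simp
  from has_derivative_diff[OF weight_deriv[OF x, of s q e] has_derivative_mult_right[OF this, of \<sigma>]]
  show ?thesis
    by (simp add: reduced_rhs_def[abs_def] reduced_rhs'_def[abs_def] mult.commute)
qed

lemma reduced_rhs'_cont:
  assumes "0 \<notin> S" "\<And>x. x \<in> S \<Longrightarrow> u x > 0"
  shows "continuous_on {x \<in> S. G x \<noteq> 0} (\<lambda>x. reduced_rhs' \<sigma> s q e x v)"
proof -
  have "continuous_on {x \<in> S. G x \<noteq> 0} u" "continuous_on {x \<in> S. G x \<noteq> 0} G"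
    "continuous_on {x \<in> S. G x \<noteq> 0} (\<lambda>x. H x v)"
    using continuous_on_subset[OF u_cont] continuous_on_subset[OF G_cont] continuous_on_subset[OF H_cont] by auto
  moreover have "x \<noteq> 0" "u x \<noteq> 0" if "x \<in> S" for x
    using assms that by (auto simp: less_imp_neq[symmetric])
  ultimately show ?thesis
    unfolding reduced_rhs'_def weight'_def weight_def
    by (intro continuous_intros) auto
qed

lemma p_trace_eq_reduced_rhs:
  assumes x: "x \<in> S" "x \<noteq> 0" "u x > 0" "G x \<noteq> 0"
    and d: "has_divergence (flux p \<sigma> u) (norm x powr (- \<tau>) * rpow (u x) q * rpow (norm (G x)) m) x"
  shows "p_trace p (sgn (G x)) (H x) = reduced_rhs \<sigma> (\<sigma> + \<tau>) q (m - p + 2) x"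
proof -
  have rp: "rpow t a = t powr a" if "t > 0" for t a using that by (simp add: rpow_def)
  have pos: "norm x powr \<sigma> * norm (G x) powr (p - 2) \<noteq> 0" using x by simp
  have "norm x powr \<sigma> * norm (G x) powr (p - 2) *
    (p_trace p (sgn (G x)) (H x) + \<sigma> * (G x \<bullet> x) / (norm x)\<^sup>2) = norm x powr (- \<tau>) * u x powr q * norm (G x) powr m"
    using divergence_flux[OF x(1,2,4) d] x by (simp add: rp)
  also have "\<dots> = norm x powr \<sigma> * norm (G x) powr (p - 2) * weight (\<sigma> + \<tau>) q (m - p + 2) x"
  proof -
    have "norm x powr (- \<tau>) = norm x powr \<sigma> * norm x powr (- (\<sigma> + \<tau>))"
      by (simp flip: powr_add)
    moreover have "norm (G x) powr m = norm (G x) powr (p - 2) * norm (G x) powr (m - p + 2)"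
      by (simp flip: powr_add)
    ultimately show ?thesis by (simp add: weight_def)
  qed
  finally show ?thesis
    unfolding mult_cancel_left using pos by (simp add: reduced_rhs_def power2_norm_eq_inner)
qed

text \<open>The bounded convex decreasing function \<open>\<kappa> a / (a + u)\<close> is what controls the region where
  \<open>u\<close> is too small for the absorption term to be of any use.\<close>

lemma bernstein_weight:
  fixes a b \<kappa> :: real and c :: "real^'n"
  assumes pos: "\<And>x. x \<in> S \<Longrightarrow> u x > 0" and a: "a > 0"
  defines "\<theta> \<equiv> \<lambda>x. \<kappa> * a / (a + u x) - b * ((x - c) \<bullet> (x - c))"
  shows "C2_on S \<theta>"
    and "\<And>x. x \<in> S \<Longrightarrow> grad \<theta> x = - (\<kappa> * a / (a + u x)\<^sup>2) *\<^sub>R G x - (2 * b) *\<^sub>R (x - c)"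
    and "\<And>x. x \<in> S \<Longrightarrow> G x \<noteq> 0 \<Longrightarrow> p_trace p (sgn (G x)) (frechet_derivative (grad \<theta>) (at x)) =
      2 * \<kappa> * a / (a + u x) ^ 3 * (norm (G x))\<^sup>2 * (p - 1)
      - \<kappa> * a / (a + u x)\<^sup>2 * p_trace p (sgn (G x)) (H x) - 2 * b * (real CARD('n) + p - 2)"
proof -
  let ?W = "\<lambda>x. (- (\<kappa> * a) * inverse ((a + u x)\<^sup>2)) *\<^sub>R G x - (2 * b) *\<^sub>R (x - c)"
  let ?D = "\<lambda>x v. (- (\<kappa> * a) * inverse ((a + u x)\<^sup>2)) *\<^sub>R H x v
     + (2 * \<kappa> * a / (a + u x) ^ 3 * (G x \<bullet> v)) *\<^sub>R G x - (2 * b) *\<^sub>R v"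
  have au: "a + u x > 0" if "x \<in> S" for x using pos[OF that] a by simp
  have inv: "((\<lambda>y. inverse (a + u y)) has_derivative (\<lambda>v. - (inverse (a + u x) * (G x \<bullet> v) * inverse (a + u x)))) (at x)"
    if "x \<in> S" for x
    using au[OF that] has_derivative_add[OF has_derivative_const[of a] u_deriv[OF that]]
    by (intro Deriv.has_derivative_inverse) auto
  have 1: "(\<theta> has_derivative (\<lambda>v. ?W x \<bullet> v)) (at x)" if "x \<in> S" for x
  proof -
    have "((\<lambda>x. (x - c) \<bullet> (x - c)) has_derivative (\<lambda>v. (x - c) \<bullet> v + v \<bullet> (x - c))) (at x)"
      by (auto intro!: derivative_eq_intros)
    from has_derivative_diff[OF has_derivative_mult_right[OF inv[OF that], of "\<kappa> * a"] has_derivative_mult_right[OF this, of b]]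
    have "(\<theta> has_derivative (\<lambda>v. \<kappa> * a * - (inverse (a + u x) * (G x \<bullet> v) * inverse (a + u x))
       - b * ((x - c) \<bullet> v + v \<bullet> (x - c)))) (at x)"
      by (simp add: \<theta>_def divide_inverse)
    then show ?thesis
      unfolding power2_eq_square inverse_mult_distrib
      by (rule has_derivative_eq_rhs)
         (simp add: fun_eq_iff inner_diff_left inner_diff_right inner_commute algebra_simps)
  qed
  have 2: "(?W has_derivative ?D x) (at x)" if "x \<in> S" for x
  proof -
    have "((\<lambda>y. inverse (a + u y) * inverse (a + u y)) has_derivative (\<lambda>v. - 2 / (a + u x) ^ 3 * (G x \<bullet> v))) (at x)"
      by (rule has_derivative_eq_rhs[OF has_derivative_mult[OF inv[OF that] inv[OF that]]])
         (use au[OF that] in \<open>simp add: fun_eq_iff divide_inverse power3_eq_cube\<close>)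
    from has_derivative_diff[OF has_derivative_scaleR[OF has_derivative_mult_right[OF this, of "- (\<kappa> * a)"] G_deriv[OF that]]
      has_derivative_scaleR_right[OF has_derivative_diff[OF has_derivative_ident has_derivative_const[of c]], of "2 * b"]]
    show ?thesis
      unfolding power2_eq_square inverse_mult_distrib
      by (rule has_derivative_eq_rhs) (simp add: fun_eq_iff algebra_simps)
  qed
  have 3: "continuous_on S (\<lambda>x. ?D x v)" for v
    by (intro continuous_intros H_cont G_cont u_cont) (auto simp: au less_imp_neq[symmetric])
  note C = C2_onI[OF open_S, of \<theta> ?W ?D, OF 1 2 3, simplified]
  show "C2_on S \<theta>" by (rule C(1))
  show "grad \<theta> x = - (\<kappa> * a / (a + u x)\<^sup>2) *\<^sub>R G x - (2 * b) *\<^sub>R (x - c)" if "x \<in> S" for x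
    unfolding C(2)[OF that] by (simp add: divide_inverse)
  fix x assume x: "x \<in> S" "G x \<noteq> 0"
  let ?N = "sgn (G x)"
  have N: "?N \<bullet> ?N = 1" using x(2) by (simp add: norm_sgn flip: power2_norm_eq_inner)
  have GN: "G x \<bullet> ?N = norm (G x)"
    using x(2) by (simp add: sgn_div_norm power2_norm_eq_inner[symmetric] power2_eq_square)
  have s: "(\<Sum>i\<in>UNIV. G x $ i * G x $ i) = (norm (G x))\<^sup>2"
    by (simp add: power2_norm_eq_inner inner_vec_def)
  define A where "A = 2 * \<kappa> * a / (a + u x) ^ 3"
  define B where "B = - (\<kappa> * a) * inverse ((a + u x)\<^sup>2)"
  have "p_trace p ?N (?D x) = B * p_trace p ?N (H x) + A * (norm (G x))\<^sup>2 * (p - 1) - 2 * b * (real CARD('n) + p - 2)"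
    unfolding A_def[symmetric] B_def[symmetric]
    by (simp add: p_trace_def sum.distrib sum_subtractf inner_axis inner_add_left inner_diff_left N GN s
        mult.assoc sum_distrib_left[symmetric])
       (simp add: inner_commute[of "sgn (G x)"] GN power2_eq_square algebra_simps)
  then show "p_trace p ?N (frechet_derivative (grad \<theta>) (at x)) =
      2 * \<kappa> * a / (a + u x) ^ 3 * (norm (G x))\<^sup>2 * (p - 1)
      - \<kappa> * a / (a + u x)\<^sup>2 * p_trace p ?N (H x) - 2 * b * (real CARD('n) + p - 2)"
    unfolding C(3)[OF x(1)] by (simp add: A_def B_def divide_inverse mult_ac)
qed

end

section \<open>Gradient estimates\<close>

context C2_fun
begin

text \<open>The conclusion of \<open>bernstein_at_max\<close>, specialised to the weight of
  \<open>bernstein_weight\<close>, becomes a \<open>bernstein_system\<close> after multiplication by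
  r^2/|grad u|^2. The bound \<open>r \<le> norm x\<close> turns each factor 1/|x| into at most 1/r,
  and the first-order condition \<open>HG\<close> expresses all occurrences of the Hessian applied
  to the gradient through \<open>W\<close>.\<close>

lemma bernstein_scaled:
  assumes x: "x \<in> S" "u x > 0" "G x \<noteq> 0"
    and r: "r > 0" "r \<le> norm x" "norm (x - c) \<le> r"
    and pos: "B \<ge> 0" "a > 0" "\<kappa> > 0" "q \<ge> 0"
    and eq: "p_trace p (sgn (G x)) (H x) = reduced_rhs \<sigma> s q e x"
    and \<psi>: "\<psi> = \<kappa> * a / (a + u x)\<^sup>2" and P: "P = 2 * \<kappa> * a / (a + u x) ^ 3"
    and W: "W = - \<psi> *\<^sub>R G x - (2 * (B / r\<^sup>2)) *\<^sub>R (x - c)"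
    and HG: "2 *\<^sub>R H x (G x) = - (norm (G x))\<^sup>2 *\<^sub>R W"
    and main: "S2 + reduced_rhs' \<sigma> s q e x (G x) \<le> (norm (G x))\<^sup>2 * (p / 4 * (norm W)\<^sup>2 -
      (P * (norm (G x))\<^sup>2 * (p - 1) - \<psi> * reduced_rhs \<sigma> s q e x - 2 * (B / r\<^sup>2) * (real CARD('n) + p - 2)) / 2)"
    and S2: "S2 = (\<Sum>i\<in>UNIV. (norm (H x (axis i 1)))\<^sup>2)"
    and \<phi>: "\<phi> = r * weight s q e x / norm (G x)" and S0: "S0 = r\<^sup>2 * S2 / (norm (G x))\<^sup>2"
    and w: "w = r * norm W" and \<omega>: "\<omega> = r * \<psi> * norm (G x)" and T: "T = r\<^sup>2 * P * (norm (G x))\<^sup>2"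
  shows "bernstein_system (real CARD('n)) p s e \<sigma> \<kappa> B \<phi> S0 w \<omega> T"
proof -
  define \<nu> where "\<nu> = norm (G x)"
  define f where "f = weight s q e x"
  have \<nu>: "\<nu> > 0" using x by (simp add: \<nu>_def)
  have GG: "G x \<bullet> G x = \<nu>\<^sup>2" by (simp add: \<nu>_def power2_norm_eq_inner)
  have x0: "x \<noteq> 0" using r by auto
  have f: "f > 0" using x x0 by (simp add: f_def weight_def)
  have au: "a + u x > 0" using pos x by simp
  have \<psi>0: "\<psi> \<ge> 0" and P0: "P \<ge> 0" using pos au by (auto simp: \<psi> P)
  have quot: "\<bar>(y \<bullet> x) / (x \<bullet> x)\<bar> \<le> norm y / r" for y
  proof -
    have "\<bar>(y \<bullet> x) / (x \<bullet> x)\<bar> \<le> (norm y * norm x) / (norm x)\<^sup>2"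
      using Cauchy_Schwarz_ineq2[of y x] by (simp add: power2_norm_eq_inner[symmetric] divide_right_mono)
    also have "\<dots> = norm y / norm x" using x0 by (simp add: power2_eq_square)
    also have "\<dots> \<le> norm y / r" using r x0 by (intro divide_left_mono) auto
    finally show ?thesis .
  qed
  have inv: "1 / (x \<bullet> x) \<le> 1 / r\<^sup>2"
    using r by (simp add: power2_norm_eq_inner[symmetric] frac_le)
  have HGy: "H x (G x) \<bullet> y = - \<nu>\<^sup>2 / 2 * (W \<bullet> y)" for y
  proof -
    have "2 * (H x (G x) \<bullet> y) = (2 *\<^sub>R H x (G x)) \<bullet> y" by simp
    also have "\<dots> = - \<nu>\<^sup>2 * (W \<bullet> y)" unfolding HG by (simp add: \<nu>_def)
    finally show ?thesis by simp
  qed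
  have WG: "\<bar>W \<bullet> G x\<bar> \<le> norm W * \<nu>" unfolding \<nu>_def by (rule Cauchy_Schwarz_ineq2)
  let ?A = "G x \<bullet> x / (x \<bullet> x)"
  have A: "\<bar>?A\<bar> \<le> \<nu> / r" unfolding \<nu>_def by (rule quot)
  have \<sigma>A: "\<bar>\<sigma> * ?A\<bar> \<le> \<bar>\<sigma>\<bar> * (\<nu> / r)" unfolding abs_mult using A by (intro mult_left_mono) auto
  have g: "reduced_rhs \<sigma> s q e x = f - \<sigma> * ?A" by (simp add: reduced_rhs_def f_def)
  have b1: "w \<le> 2 * B + \<omega>"
  proof -
    have "norm W \<le> norm (- \<psi> *\<^sub>R G x) + norm ((2 * (B / r\<^sup>2)) *\<^sub>R (x - c))"
      unfolding W by (rule norm_triangle_ineq4)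
    also have "\<dots> = \<psi> * \<nu> + 2 * (B / r\<^sup>2) * norm (x - c)" using \<psi>0 pos by (simp add: \<nu>_def)
    also have "\<dots> \<le> \<psi> * \<nu> + 2 * (B / r\<^sup>2) * r" using r pos by (intro add_left_mono mult_left_mono) auto
    finally have "w \<le> r * (\<psi> * \<nu> + 2 * (B / r\<^sup>2) * r)" unfolding w using r by (intro mult_left_mono) auto
    also have "\<dots> = 2 * B + \<omega>" using r by (simp add: \<omega> \<nu>_def field_simps power2_eq_square)
    finally show ?thesis .
  qed
  \<comment> \<open>Here the shape \<kappa>a/(a + u) pays off: the square of its first derivative is
    at most \<kappa>/2 times its second derivative, as a/(a + u) is below 1.\<close>
  have b2: "\<omega>\<^sup>2 \<le> \<kappa> / 2 * T"
  proof -
    have "\<psi>\<^sup>2 = \<kappa> / 2 * P * (a / (a + u x))"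
      using au by (simp add: \<psi> P power2_eq_square power3_eq_cube mult.assoc mult.left_commute[of a])
    also have "\<dots> \<le> \<kappa> / 2 * P * 1" using pos x P0 by (intro mult_left_mono) auto
    finally have "r\<^sup>2 * \<nu>\<^sup>2 * \<psi>\<^sup>2 \<le> r\<^sup>2 * \<nu>\<^sup>2 * (\<kappa> / 2 * P)" by (intro mult_left_mono) auto
    then show ?thesis by (simp add: \<omega> T \<nu>_def power_mult_distrib mult_ac)
  qed
  \<comment> \<open>The equation replaces \<open>reduced_rhs\<close> by \<open>p_trace\<close>, so
    \<open>p_trace_square_le\<close> applies; the second derivative along the gradient is -(W . G)/2
    by the first-order condition, whence the term in w^2. The drift is then added back to recover
    the absorption term.\<close>
  have b3: "\<phi>\<^sup>2 \<le> 4 * real CARD('n) * S0 + (p - 2)\<^sup>2 * w\<^sup>2 + 2 * \<sigma>\<^sup>2"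
  proof -
    have two: "(y + z)\<^sup>2 \<le> 2 * y\<^sup>2 + 2 * z\<^sup>2" for y z :: real
      using zero_le_power2[of "y - z"] by (simp add: power2_eq_square algebra_simps)
    have "inverse \<nu> * (inverse \<nu> * (\<nu> * \<nu>)) = 1" using \<nu> by (simp add: field_simps)
    then have "H x (sgn (G x)) \<bullet> sgn (G x) = - (W \<bullet> G x) / 2"
      using HGy[of "G x"] \<nu> by (simp add: sgn_div_norm linear_scale[OF H_linear[OF x(1)]] \<nu>_def[symmetric] power2_eq_square)
    then have "(H x (sgn (G x)) \<bullet> sgn (G x))\<^sup>2 = \<bar>W \<bullet> G x\<bar>\<^sup>2 / 4" by (simp add: power_divide)
    also have "\<dots> \<le> (norm W * \<nu>)\<^sup>2 / 4" using WG by (intro divide_right_mono power_mono) auto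
    finally have 1: "(p - 2)\<^sup>2 * (H x (sgn (G x)) \<bullet> sgn (G x))\<^sup>2 \<le> (p - 2)\<^sup>2 * ((norm W * \<nu>)\<^sup>2 / 4)"
      by (intro mult_left_mono) auto
    have "(reduced_rhs \<sigma> s q e x)\<^sup>2 \<le> 2 * real CARD('n) * S2 + 2 * (p - 2)\<^sup>2 * (H x (sgn (G x)) \<bullet> sgn (G x))\<^sup>2"
      using p_trace_square_le[OF x(1), of p "sgn (G x)"] unfolding eq S2 .
    then have 2: "(reduced_rhs \<sigma> s q e x)\<^sup>2 \<le> 2 * real CARD('n) * S2 + (p - 2)\<^sup>2 * (norm W * \<nu>)\<^sup>2 / 2"
      using 1 by simp
    have "f\<^sup>2 \<le> 2 * (reduced_rhs \<sigma> s q e x)\<^sup>2 + 2 * \<bar>\<sigma> * ?A\<bar>\<^sup>2"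
      using two[of "reduced_rhs \<sigma> s q e x" "\<sigma> * ?A"] unfolding g power2_abs by simp
    also have "\<bar>\<sigma> * ?A\<bar>\<^sup>2 \<le> (\<bar>\<sigma>\<bar> * (\<nu> / r))\<^sup>2" using \<sigma>A by (intro power_mono) auto
    finally have "f\<^sup>2 \<le> 4 * real CARD('n) * S2 + (p - 2)\<^sup>2 * (norm W * \<nu>)\<^sup>2 + 2 * (\<bar>\<sigma>\<bar> * (\<nu> / r))\<^sup>2"
      using 2 by simp
    from mult_left_mono[OF this, of "r\<^sup>2 / \<nu>\<^sup>2"]
    have "r\<^sup>2 / \<nu>\<^sup>2 * f\<^sup>2 \<le> r\<^sup>2 / \<nu>\<^sup>2 * (4 * real CARD('n) * S2 + (p - 2)\<^sup>2 * (norm W * \<nu>)\<^sup>2 + 2 * (\<bar>\<sigma>\<bar> * (\<nu> / r))\<^sup>2)"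
      by simp
    also have "\<dots> = 4 * real CARD('n) * S0 + (p - 2)\<^sup>2 * w\<^sup>2 + 2 * \<sigma>\<^sup>2"
      using \<nu> r by (simp add: S0 w \<nu>_def[symmetric] distrib_left power_mult_distrib power_divide)
    finally show ?thesis by (simp add: \<phi> f_def \<nu>_def power_mult_distrib power_divide)
  qed
  have b4: "S0 - \<phi> * (\<bar>s\<bar> + \<bar>e\<bar> * w / 2) - \<bar>\<sigma>\<bar> * (w / 2 + 3)
      \<le> p / 4 * w\<^sup>2 + B * (real CARD('n) + p - 2) - T * (p - 1) / 2 + \<omega> * (\<phi> + \<bar>\<sigma>\<bar>) / 2"
  proof -
    have 1: "weight' s q e x (G x) \<ge> - (f * (\<bar>s\<bar> * (\<nu> / r) + \<bar>e\<bar> * (norm W * \<nu> / 2)))"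
    proof -
      have "s * ?A \<le> \<bar>s\<bar> * \<bar>?A\<bar>" by (metis abs_ge_self abs_mult)
      also have "\<dots> \<le> \<bar>s\<bar> * (\<nu> / r)" using A by (intro mult_left_mono) auto
      finally have i: "s * ?A \<le> \<bar>s\<bar> * (\<nu> / r)" .
      have "e * (W \<bullet> G x / 2) \<le> \<bar>e\<bar> * \<bar>W \<bullet> G x / 2\<bar>" by (metis abs_ge_self abs_mult)
      also have "\<dots> \<le> \<bar>e\<bar> * (norm W * \<nu> / 2)" using WG by (intro mult_left_mono) auto
      finally have ii: "e * (W \<bullet> G x / 2) \<le> \<bar>e\<bar> * (norm W * \<nu> / 2)" .
      \<comment> \<open>The term from differentiating u^q has the favourable sign and is
        dropped.\<close>
      have iii: "q * \<nu>\<^sup>2 / u x \<ge> 0" using pos x by simp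
      have iv: "weight' s q e x (G x) = f * (- (s * ?A) + q * \<nu>\<^sup>2 / u x - e * (W \<bullet> G x / 2))"
        using \<nu> by (simp add: weight'_def f_def GG HGy)
      show ?thesis unfolding iv mult_minus_right[symmetric] using f i ii iii
        by (intro mult_left_mono) linarith+
    qed
    \<comment> \<open>The 3 counts one term |G|^2/|x|^2 and two terms (G . x)^2/|x|^4.\<close>
    have 2: "\<sigma> * ((G x \<bullet> G x + H x (G x) \<bullet> x) / (x \<bullet> x) - (G x \<bullet> x) * (2 * (G x \<bullet> x)) / (x \<bullet> x)\<^sup>2)
      \<le> \<bar>\<sigma>\<bar> * (\<nu>\<^sup>2 * (3 / r\<^sup>2 + norm W / r / 2))"
    proof -
      have e: "(G x \<bullet> G x + H x (G x) \<bullet> x) / (x \<bullet> x) - (G x \<bullet> x) * (2 * (G x \<bullet> x)) / (x \<bullet> x)\<^sup>2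
        = \<nu>\<^sup>2 * (1 / (x \<bullet> x)) - \<nu>\<^sup>2 / 2 * (W \<bullet> x / (x \<bullet> x)) - 2 * \<bar>?A\<bar>\<^sup>2"
        by (simp add: GG HGy add_divide_distrib diff_divide_distrib power2_eq_square)
      have "\<bar>?A\<bar>\<^sup>2 \<le> (\<nu> / r)\<^sup>2" using A by (intro power_mono) auto
      then have e1: "0 \<le> \<bar>?A\<bar>\<^sup>2" "\<bar>?A\<bar>\<^sup>2 \<le> \<nu>\<^sup>2 * (1 / r\<^sup>2)" by (simp_all add: power_divide)
      have e2: "0 \<le> \<nu>\<^sup>2 * (1 / (x \<bullet> x))" "\<nu>\<^sup>2 * (1 / (x \<bullet> x)) \<le> \<nu>\<^sup>2 * (1 / r\<^sup>2)"
        using mult_left_mono[OF inv, of "\<nu>\<^sup>2"] by simp_all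
      have "\<bar>\<nu>\<^sup>2 / 2 * (W \<bullet> x / (x \<bullet> x))\<bar> \<le> \<nu>\<^sup>2 / 2 * (norm W / r)"
        unfolding abs_mult[of "\<nu>\<^sup>2 / 2"] using mult_left_mono[OF quot[of W], of "\<nu>\<^sup>2 / 2"] by simp
      then have "\<bar>\<nu>\<^sup>2 * (1 / (x \<bullet> x)) - \<nu>\<^sup>2 / 2 * (W \<bullet> x / (x \<bullet> x)) - 2 * \<bar>?A\<bar>\<^sup>2\<bar>
        \<le> \<nu>\<^sup>2 * (1 / r\<^sup>2) + \<nu>\<^sup>2 / 2 * (norm W / r) + 2 * (\<nu>\<^sup>2 * (1 / r\<^sup>2))"
        using e1 e2 by linarith
      also have "\<dots> = \<nu>\<^sup>2 * (3 / r\<^sup>2 + norm W / r / 2)" by (simp add: algebra_simps)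
      finally have e3: "\<bar>\<nu>\<^sup>2 * (1 / (x \<bullet> x)) - \<nu>\<^sup>2 / 2 * (W \<bullet> x / (x \<bullet> x)) - 2 * \<bar>?A\<bar>\<^sup>2\<bar> \<le> \<nu>\<^sup>2 * (3 / r\<^sup>2 + norm W / r / 2)" .
      have "\<sigma> * z \<le> \<bar>\<sigma>\<bar> * \<bar>z\<bar>" for z by (metis abs_ge_self abs_mult)
      then show ?thesis unfolding e using e3 by (meson abs_ge_zero mult_left_mono order_trans)
    qed
    have "\<psi> * reduced_rhs \<sigma> s q e x \<le> \<psi> * (f + \<bar>\<sigma>\<bar> * (\<nu> / r))"
      using \<sigma>A \<psi>0 unfolding g by (intro mult_left_mono) linarith+
    then have 3: "(norm (G x))\<^sup>2 * (p / 4 * (norm W)\<^sup>2 -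
      (P * (norm (G x))\<^sup>2 * (p - 1) - \<psi> * reduced_rhs \<sigma> s q e x - 2 * (B / r\<^sup>2) * (real CARD('n) + p - 2)) / 2)
      \<le> \<nu>\<^sup>2 * (p / 4 * (norm W)\<^sup>2 -
      (P * \<nu>\<^sup>2 * (p - 1) - \<psi> * (f + \<bar>\<sigma>\<bar> * (\<nu> / r)) - 2 * (B / r\<^sup>2) * (real CARD('n) + p - 2)) / 2)"
      unfolding \<nu>_def by (intro mult_left_mono) auto
    have "S2 - f * (\<bar>s\<bar> * (\<nu> / r) + \<bar>e\<bar> * (norm W * \<nu> / 2)) - \<bar>\<sigma>\<bar> * (\<nu>\<^sup>2 * (3 / r\<^sup>2 + norm W / r / 2))
      \<le> \<nu>\<^sup>2 * (p / 4 * (norm W)\<^sup>2 -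
      (P * \<nu>\<^sup>2 * (p - 1) - \<psi> * (f + \<bar>\<sigma>\<bar> * (\<nu> / r)) - 2 * (B / r\<^sup>2) * (real CARD('n) + p - 2)) / 2)"
      using main 1 2 3 unfolding reduced_rhs'_def by linarith
    from mult_left_mono[OF this, of "r\<^sup>2 / \<nu>\<^sup>2"]
    have "r\<^sup>2 / \<nu>\<^sup>2 * (S2 - f * (\<bar>s\<bar> * (\<nu> / r) + \<bar>e\<bar> * (norm W * \<nu> / 2)) - \<bar>\<sigma>\<bar> * (\<nu>\<^sup>2 * (3 / r\<^sup>2 + norm W / r / 2)))
      \<le> r\<^sup>2 / \<nu>\<^sup>2 * (\<nu>\<^sup>2 * (p / 4 * (norm W)\<^sup>2 -
      (P * \<nu>\<^sup>2 * (p - 1) - \<psi> * (f + \<bar>\<sigma>\<bar> * (\<nu> / r)) - 2 * (B / r\<^sup>2) * (real CARD('n) + p - 2)) / 2))"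
      by simp
    also have "r\<^sup>2 / \<nu>\<^sup>2 * (S2 - f * (\<bar>s\<bar> * (\<nu> / r) + \<bar>e\<bar> * (norm W * \<nu> / 2)) - \<bar>\<sigma>\<bar> * (\<nu>\<^sup>2 * (3 / r\<^sup>2 + norm W / r / 2)))
      = S0 - \<phi> * (\<bar>s\<bar> + \<bar>e\<bar> * w / 2) - \<bar>\<sigma>\<bar> * (w / 2 + 3)"
      using \<nu> r unfolding S0 \<phi> w \<nu>_def[symmetric] f_def[symmetric] by (simp add: field_simps power2_eq_square)
    also have "r\<^sup>2 / \<nu>\<^sup>2 * (\<nu>\<^sup>2 * (p / 4 * (norm W)\<^sup>2 -
      (P * \<nu>\<^sup>2 * (p - 1) - \<psi> * (f + \<bar>\<sigma>\<bar> * (\<nu> / r)) - 2 * (B / r\<^sup>2) * (real CARD('n) + p - 2)) / 2))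
      = p / 4 * w\<^sup>2 + B * (real CARD('n) + p - 2) - T * (p - 1) / 2 + \<omega> * (\<phi> + \<bar>\<sigma>\<bar>) / 2"
      using \<nu> r unfolding w T \<omega> \<phi> \<nu>_def[symmetric] f_def[symmetric] by (simp add: field_simps power2_eq_square)
    finally show ?thesis .
  qed
  have "0 \<le> \<phi>" "0 \<le> w" "0 \<le> \<omega>" "0 \<le> T"
    using r f \<psi>0 P0 by (simp_all add: \<phi> w \<omega> T f_def)
  with b1 b2 b3 b4 show ?thesis unfolding bernstein_system_def by simp
qed

end

text \<open>The sign of the exponent is open, so the power may increase or decrease; either way its
  least value on the interval is at an endpoint. It is used for the exponents m - p + 1 and
  -(\<sigma> + \<tau>).\<close>

lemma powr_ge_on_interval:
  fixes a b t x M :: real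
  assumes "0 < a" "0 < M" "a * M \<le> x" "x \<le> b * M"
  shows "min (a powr t) (b powr t) * M powr t \<le> x powr t"
proof (cases "t \<ge> 0")
  case True
  have "min (a powr t) (b powr t) * M powr t \<le> a powr t * M powr t" by (intro mult_right_mono) auto
  also have "\<dots> = (a * M) powr t" using assms by (simp add: powr_mult)
  also have "\<dots> \<le> x powr t" using assms True by (intro powr_mono2) auto
  finally show ?thesis .
next
  case False
  have x: "0 < x" using assms by (meson less_le_trans mult_pos_pos)
  then have "0 < b" using assms by (metis less_le_trans zero_less_mult_pos2)
  have "min (a powr t) (b powr t) * M powr t \<le> b powr t * M powr t" by (intro mult_right_mono) auto
  also have "\<dots> = (b * M) powr t" using assms \<open>0 < b\<close> by (simp add: powr_mult)
  also have "\<dots> \<le> x powr t" using assms x False by (intro powr_mono2') auto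
  finally show ?thesis .
qed

text \<open>The point x of the conclusion is the maximum point of the Bernstein function. Its
  position in the ball is unknown, so the power of |x| is left at x here and compared with the scale
  of the ball only in \<open>interior_gradient_estimate\<close>.\<close>

lemma local_gradient_estimate:
  fixes m p q \<sigma> \<tau> \<Lambda> :: real
  assumes p: "p > 1" and q: "q \<ge> 0" and \<Lambda>: "\<Lambda> \<ge> 1"
  shows "\<exists>C>0. \<forall>(S :: (real^'n) set) u c r M.
    open S \<and> 0 \<notin> S \<and> C2_on S u \<and> (\<forall>x\<in>S. u x > 0) \<and>
    (\<forall>x\<in>S. has_divergence (flux p \<sigma> u) (norm x powr (- \<tau>) * rpow (u x) q * rpow (norm (grad u x)) m) x) \<and>
    r > 0 \<and> M > 0 \<and> cball c r \<subseteq> S \<and> (\<forall>x\<in>cball c r. r \<le> norm x \<and> norm (grad u x) \<le> \<Lambda> * M) \<and>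
    norm (grad u c) = M \<longrightarrow>
    (\<exists>x\<in>cball c r. M powr (m + q - p + 1) * r powr (q + 1) * norm x powr (- (\<sigma> + \<tau>)) \<le> C)"
proof -
  define s where "s = \<sigma> + \<tau>"
  define e where "e = m - p + 2"
  have "real CARD('n) \<ge> 1" by (simp add: Suc_leI)
  from absorption[OF this p, of s e \<sigma>]
  obtain \<kappa> where \<kappa>: "\<kappa> > 0" and abs0: "\<forall>B\<ge>0. \<exists>K>0. \<forall>\<phi> S w \<omega> T.
    bernstein_system (real CARD('n)) p s e \<sigma> \<kappa> B \<phi> S w \<omega> T
    \<longrightarrow> \<phi>\<^sup>2 \<le> K \<and> T \<le> K" by blast
  \<comment> \<open>On the sphere the exponent is then at most \<kappa> - B = -1 - ln(\<Lambda>^2),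
    which compensates the factor \<Lambda>^2 in |grad u|^2 and leaves exp(-1) to spare. The centre,
    where the exponent is positive, therefore beats the sphere.\<close>
  define B where "B = \<kappa> + 2 * ln \<Lambda> + 1"
  have B: "B \<ge> 0" using \<kappa> \<Lambda> by (simp add: B_def)
  obtain K where K: "K > 0" and absorb: "\<And>\<phi> S w \<omega> T.
    bernstein_system (real CARD('n)) p s e \<sigma> \<kappa> B \<phi> S w \<omega> T
    \<Longrightarrow> \<phi>\<^sup>2 \<le> K \<and> T \<le> K" using abs0 B by meson
  \<comment> \<open>With this \<delta>, u \<le> a at the maximum would force the quantity
    \<open>T\<close>, bounded by \<open>K\<close>, to be at least 2K.\<close>
  define \<delta> where "\<delta> = sqrt (\<kappa> * exp (- \<kappa>) / (8 * K))"
  have \<delta>: "\<delta> > 0" "\<delta>\<^sup>2 = \<kappa> * exp (- \<kappa>) / (8 * K)" using \<kappa> K by (simp_all add: \<delta>_def)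
  \<comment> \<open>The gradient at the maximum will lie between exp(-\<kappa>/2) M and \<Lambda> M,
    and \<open>c0\<close> is the worst case of its power m - p + 1 over that range.\<close>
  define c0 where "c0 = min (exp (- \<kappa> / 2) powr (m - p + 1)) (\<Lambda> powr (m - p + 1))"
  have c0: "c0 > 0" using \<Lambda> by (simp add: c0_def)
  define C where "C = sqrt K / (\<delta> powr q * c0)"
  have C: "C > 0" using K \<delta> c0 by (simp add: C_def)
  show ?thesis
  proof (rule exI[of _ C], intro conjI[OF C] allI impI, elim conjE)
    fix S :: "(real^'n) set" and u c r M
    assume S: "open S" "0 \<notin> S" "C2_on S u" and upos: "\<forall>x\<in>S. u x > 0"
      and equation: "\<forall>x\<in>S. has_divergence (flux p \<sigma> u) (norm x powr (- \<tau>) * rpow (u x) q * rpow (norm (grad u x)) m) x"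
      and r: "r > 0" and M: "M > 0" and cb: "cball c r \<subseteq> S"
      and ball: "\<forall>x\<in>cball c r. r \<le> norm x \<and> norm (grad u x) \<le> \<Lambda> * M" and Gc: "norm (grad u c) = M"
    interpret C2_fun S u using S by unfold_locales auto
    define a where "a = \<delta> * M * r"
    have a: "a > 0" using \<delta> M r by (simp add: a_def)
    define \<theta> where "\<theta> = (\<lambda>x. \<kappa> * a / (a + u x) - B / r\<^sup>2 * ((x - c) \<bullet> (x - c)))"
    note bw = bernstein_weight[OF _ a, where \<kappa> = \<kappa> and b = "B / r\<^sup>2" and c = c, folded \<theta>_def]
    have up: "\<And>x. x \<in> S \<Longrightarrow> u x > 0" using upos by blast
    have eq: "p_trace p (sgn (G x)) (H x) = reduced_rhs \<sigma> s q e x" if "x \<in> S" "G x \<noteq> 0" for x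
      using p_trace_eq_reduced_rhs[of x p \<sigma> \<tau> q m] that S(2) up equation unfolding s_def e_def by metis
    have rd: "(reduced_rhs \<sigma> s q e has_derivative reduced_rhs' \<sigma> s q e x) (at x)" if "x \<in> S" "G x \<noteq> 0" for x
      using reduced_rhs_deriv[of x] that S(2) up by metis
    have \<theta>_le: "\<theta> x \<le> \<kappa> - B / r\<^sup>2 * (norm (x - c))\<^sup>2" if "x \<in> S" for x
      using up[OF that] a \<kappa> by (simp add: \<theta>_def power2_norm_eq_inner field_simps)
    have cS: "c \<in> S" "c \<in> cball c r" using cb r by auto
    have \<theta>c: "\<theta> c > 0" using up[OF cS(1)] a \<kappa> by (simp add: \<theta>_def)
    have bd: "(norm (G x))\<^sup>2 * exp (\<theta> x) < (norm (G c))\<^sup>2 * exp (\<theta> c)" if "x \<in> sphere c r" for x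
    proof -
      have x: "x \<in> cball c r" "norm (x - c) = r" using that by (auto simp: dist_norm norm_minus_commute)
      then have "\<theta> x \<le> \<kappa> - B" using \<theta>_le[of x] cb r by auto
      also have "\<dots> = - 1 + - (ln (\<Lambda>\<^sup>2))" using \<Lambda> by (simp add: B_def ln_realpow)
      finally have "exp (\<theta> x) \<le> exp (- 1) * (1 / \<Lambda>\<^sup>2)"
        using \<Lambda> by (metis exp_add exp_le_cancel_iff exp_minus exp_ln inverse_eq_divide less_le_trans zero_less_one zero_less_power)
      moreover have "(norm (G x))\<^sup>2 \<le> (\<Lambda> * M)\<^sup>2" using ball x by (intro power_mono) auto
      ultimately have "(norm (G x))\<^sup>2 * exp (\<theta> x) \<le> (\<Lambda> * M)\<^sup>2 * (exp (- 1) * (1 / \<Lambda>\<^sup>2))"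
        by (intro mult_mono) auto
      also have "\<dots> = M\<^sup>2 * exp (- 1)" using \<Lambda> by (simp add: power_mult_distrib)
      also have "\<dots> < M\<^sup>2 * exp (\<theta> c)" using M \<theta>c by (intro mult_strict_left_mono) auto
      finally show ?thesis using Gc by simp
    qed
    have Gc0: "G c \<noteq> 0" using Gc M by auto
    obtain X where X: "X \<in> ball c r" "G X \<noteq> 0"
      "\<And>x. x \<in> cball c r \<Longrightarrow> (norm (G x))\<^sup>2 * exp (\<theta> x) \<le> (norm (G X))\<^sup>2 * exp (\<theta> X)"
      "2 *\<^sub>R H X (G X) = - (norm (G X))\<^sup>2 *\<^sub>R grad \<theta> X"
      "(\<Sum>i\<in>UNIV. (norm (H X (axis i 1)))\<^sup>2) + reduced_rhs' \<sigma> s q e X (G X) \<le> (norm (G X))\<^sup>2 *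
      (p / 4 * (norm (grad \<theta> X))\<^sup>2 - p_trace p (sgn (G X)) (frechet_derivative (grad \<theta>) (at X)) / 2)"
      by (rule bernstein_at_max[OF p cb bw(1)[OF up] eq rd reduced_rhs'_cont[OF S(2) up] cS(2) Gc0 bd]) blast+
    have Xc: "X \<in> cball c r" using X(1) by auto
    then have XS: "X \<in> S" using cb by blast
    have Xn: "r \<le> norm X" "norm (X - c) \<le> r" using ball Xc by (auto simp: dist_norm norm_minus_commute)
    define \<nu> where "\<nu> = norm (G X)"
    have \<nu>: "\<nu> > 0" using X(2) by (simp add: \<nu>_def)
    have \<nu>_le: "\<nu> \<le> \<Lambda> * M" using ball Xc by (simp add: \<nu>_def)
    have \<nu>_ge: "M\<^sup>2 * exp (- \<kappa>) \<le> \<nu>\<^sup>2"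
    proof -
      have "M\<^sup>2 * 1 \<le> M\<^sup>2 * exp (\<theta> c)" using \<theta>c by (intro mult_left_mono) auto
      also have "\<dots> \<le> \<nu>\<^sup>2 * exp (\<theta> X)" using X(3)[OF cS(2)] Gc by (simp add: \<nu>_def)
      also have "\<dots> \<le> \<nu>\<^sup>2 * exp \<kappa>"
      proof -
        have "B / r\<^sup>2 * (norm (X - c))\<^sup>2 \<ge> 0" using B by simp
        then have "\<theta> X \<le> \<kappa>" using \<theta>_le[OF XS] by linarith
        then show ?thesis by (intro mult_left_mono) auto
      qed
      finally show ?thesis by (simp add: exp_minus field_simps)
    qed
    have \<nu>_ge': "exp (- \<kappa> / 2) * M \<le> \<nu>"
    proof (rule power2_le_imp_le)
      have "(exp (- \<kappa> / 2))\<^sup>2 = exp (- \<kappa>)" by (simp flip: exp_double)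
      then show "(exp (- \<kappa> / 2) * M)\<^sup>2 \<le> \<nu>\<^sup>2" using \<nu>_ge by (simp add: power_mult_distrib mult.commute)
    qed (use \<nu> in simp)
    define P where "P = 2 * \<kappa> * a / (a + u X) ^ 3"
    define \<psi> where "\<psi> = \<kappa> * a / (a + u X)\<^sup>2"
    have gradX: "grad \<theta> X = - \<psi> *\<^sub>R G X - (2 * (B / r\<^sup>2)) *\<^sub>R (X - c)"
      using bw(2)[of X] up XS unfolding \<psi>_def by blast
    have trX: "p_trace p (sgn (G X)) (frechet_derivative (grad \<theta>) (at X)) =
      P * (norm (G X))\<^sup>2 * (p - 1) - \<psi> * reduced_rhs \<sigma> s q e X - 2 * (B / r\<^sup>2) * (real CARD('n) + p - 2)"
      using bw(3)[of X] up XS X(2) unfolding \<psi>_def P_def eq[OF XS X(2), symmetric] by blast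
    from absorb[OF bernstein_scaled[OF XS up[OF XS] X(2) r Xn B a \<kappa> q eq[OF XS X(2)] \<psi>_def P_def gradX X(4)
          X(5)[unfolded trX] refl refl refl refl refl refl]]
    have main: "(r * weight s q e X / \<nu>)\<^sup>2 \<le> K \<and> r\<^sup>2 * P * \<nu>\<^sup>2 \<le> K"
      unfolding \<nu>_def .
    \<comment> \<open>If u \<le> a, then a + u \<le> 2a bounds the second derivative
      \<open>P\<close> of the convex weight from below; with a = \<delta> M r all of r and M cancel
      in the resulting bound.\<close>
    have ua: "u X > a"
    proof (rule ccontr)
      assume "\<not> u X > a"
      then have "(a + u X) ^ 3 \<le> (2 * a) ^ 3" using a up[OF XS] by (intro power_mono) auto
      then have "2 * \<kappa> * a / (2 * a) ^ 3 \<le> P"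
        unfolding P_def using \<kappa> a up[OF XS] by (intro divide_left_mono) auto
      then have "r\<^sup>2 * (2 * \<kappa> * a / (2 * a) ^ 3) * (M\<^sup>2 * exp (- \<kappa>)) \<le> r\<^sup>2 * P * \<nu>\<^sup>2"
        using \<nu>_ge \<kappa> a up[OF XS] by (intro mult_mono) (auto simp: P_def)
      moreover have "r\<^sup>2 * (2 * \<kappa> * a / (2 * a) ^ 3) * (M\<^sup>2 * exp (- \<kappa>)) = \<kappa> * exp (- \<kappa>) / (4 * \<delta>\<^sup>2)"
        using a r M \<delta>(1) by (simp add: a_def power2_eq_square power3_eq_cube field_simps)
      moreover have "\<dots> = 2 * K" unfolding \<delta>(2) using \<kappa> K by simp
      ultimately have "2 * K \<le> r\<^sup>2 * P * \<nu>\<^sup>2" by (simp only:)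
      also have "\<dots> \<le> K" using main by blast
      finally show False using K by simp
    qed
    have "r * (weight s q e X / \<nu>) \<le> sqrt K"
      using real_le_rsqrt[of "r * weight s q e X / \<nu>" K] main by simp
    moreover have "weight s q e X / \<nu> = norm X powr (- s) * u X powr q * \<nu> powr (m - p + 1)"
    proof -
      have "\<nu> powr e = \<nu> powr (m - p + 1) * \<nu>"
        using \<nu> powr_add[of \<nu> "m - p + 1" 1] by (simp add: e_def add.commute)
      then show ?thesis using \<nu> by (simp add: weight_def \<nu>_def[symmetric])
    qed
    ultimately have 1: "r * (norm X powr (- s) * u X powr q * \<nu> powr (m - p + 1)) \<le> sqrt K" by (simp only:)
    \<comment> \<open>The lower bounds on u and on the gradient turn the estimate of the absorption
      term into an estimate of M.\<close>
    have "a powr q * (c0 * M powr (m - p + 1)) \<le> u X powr q * \<nu> powr (m - p + 1)"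
      using powr_ge_on_interval[OF _ M \<nu>_ge' \<nu>_le, of "m - p + 1"] ua a q c0 unfolding c0_def
      by (intro mult_mono powr_mono2) (auto simp: mult_nonneg_nonneg)
    then have "r * norm X powr (- s) * (a powr q * (c0 * M powr (m - p + 1)))
       \<le> r * norm X powr (- s) * (u X powr q * \<nu> powr (m - p + 1))" using r by (intro mult_left_mono) auto
    also have "\<dots> \<le> sqrt K" using 1 by (simp add: mult.assoc)
    finally have 2: "r * norm X powr (- s) * (a powr q * (c0 * M powr (m - p + 1))) \<le> sqrt K" .
    have "a powr q = \<delta> powr q * M powr q * r powr q"
      using \<delta> M r by (simp add: a_def powr_mult)
    moreover have "M powr (m + q - p + 1) = M powr q * M powr (m - p + 1)"
      by (simp flip: powr_add add: algebra_simps)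
    moreover have "r powr (q + 1) = r powr q * r" using r by (simp add: powr_add)
    ultimately have "r * norm X powr (- s) * (a powr q * (c0 * M powr (m - p + 1)))
      = (\<delta> powr q * c0) * (M powr (m + q - p + 1) * r powr (q + 1) * norm X powr (- s))"
      by (simp add: mult_ac)
    from 2[unfolded this] have "M powr (m + q - p + 1) * r powr (q + 1) * norm X powr (- s) \<le> C"
      using \<delta>(1) c0 by (simp add: C_def pos_le_divide_eq mult.commute)
    then show "\<exists>x\<in>cball c r. M powr (m + q - p + 1) * r powr (q + 1) * norm x powr (- (\<sigma> + \<tau>)) \<le> C"
      using Xc unfolding s_def by blast
  qed
qed

text \<open>The hypothesis |grad u| \<le> \<Lambda> M of the local estimate holds near a suitable
  point c rather than near y. Maximising the gradient times a power of the distance to the boundary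
  selects c and also carries the bound at c back to y.\<close>

lemma interior_gradient_estimate:
  fixes m p q \<sigma> \<tau> k :: real
  assumes p: "p > 1" and q: "q \<ge> 0" and k: "k = m + q - p + 1" "k > 0"
  shows "\<exists>C>0. \<forall>(S :: (real^'n) set) u y.
    open S \<and> 0 \<notin> S \<and> C2_on S u \<and> (\<forall>x\<in>S. u x > 0) \<and>
    (\<forall>x\<in>S. has_divergence (flux p \<sigma> u) (norm x powr (- \<tau>) * rpow (u x) q * rpow (norm (grad u x)) m) x) \<and>
    y \<noteq> 0 \<and> cball y (norm y / 2) \<subseteq> S \<longrightarrow>
    norm (grad u y) \<le> C * norm y powr (- ((q + 1 - \<sigma> - \<tau>) / k))"
proof -
  define s where "s = \<sigma> + \<tau>"
  define \<beta> where "\<beta> = (q + 1) / k"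
  have \<beta>: "\<beta> > 0" "\<beta> * k = q + 1" using q k by (auto simp: \<beta>_def)
  \<comment> \<open>The ratio \<Lambda> is taken as 2^\<beta>: on a ball about c of half the
    distance to the boundary, that distance drops at most by a factor 2.\<close>
  have "2 powr \<beta> \<ge> 1" using \<beta> by (simp add: ge_one_powr_ge_zero)
  from local_gradient_estimate[OF p q this, where ?'n = 'n, of \<sigma> \<tau> m, folded k(1)]
  obtain C where C: "C > 0" and est: "\<And>(S :: (real^'n) set) u c r M.
    open S \<and> 0 \<notin> S \<and> C2_on S u \<and> (\<forall>x\<in>S. u x > 0) \<and>
    (\<forall>x\<in>S. has_divergence (flux p \<sigma> u) (norm x powr (- \<tau>) * rpow (u x) q * rpow (norm (grad u x)) m) x) \<and>
    r > 0 \<and> M > 0 \<and> cball c r \<subseteq> S \<and> (\<forall>x\<in>cball c r. r \<le> norm x \<and> norm (grad u x) \<le> 2 powr \<beta> * M) \<and>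
    norm (grad u c) = M \<Longrightarrow>
    \<exists>x\<in>cball c r. M powr k * r powr (q + 1) * norm x powr (- (\<sigma> + \<tau>)) \<le> C" by metis
  \<comment> \<open>On the ball about y the norm |x| lies between R and 3R with R = |y|/2, and the
    sign of s is open.\<close>
  define c3 where "c3 = min (1 powr (- s)) (3 powr (- s))"
  have c3: "c3 > 0" by (simp add: c3_def)
  define C1 where "C1 = 2 powr (q + 1) * C / c3"
  have C1: "C1 > 0" using C c3 by (simp add: C1_def)
  \<comment> \<open>The power of 1/2 converts R back to |y|.\<close>
  define C2 where "C2 = C1 powr (1 / k) * (1 / 2) powr (- ((q + 1 - s) / k))"
  have C2_pos: "C2 > 0" using C1 by (simp add: C2_def)
  show ?thesis
  proof (rule exI[of _ C2], intro conjI[OF C2_pos] allI impI, elim conjE)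
    fix S :: "(real^'n) set" and u y
    assume S: "open S" "0 \<notin> S" "C2_on S u" and upos: "\<forall>x\<in>S. u x > 0"
      and equation: "\<forall>x\<in>S. has_divergence (flux p \<sigma> u) (norm x powr (- \<tau>) * rpow (u x) q * rpow (norm (grad u x)) m) x"
      and y: "y \<noteq> 0" and cb: "cball y (norm y / 2) \<subseteq> S"
    interpret C2_fun S u using S by unfold_locales auto
    define R where "R = norm y / 2"
    have R: "R > 0" using y by (simp add: R_def)
    have xR: "R \<le> norm x" "norm x \<le> 3 * R" if "x \<in> cball y R" for x
    proof -
      have "norm (y - x) \<le> R" using that by (simp add: dist_norm)
      then show "R \<le> norm x" "norm x \<le> 3 * R"
        using norm_triangle_ineq2[of y x] norm_triangle_ineq2[of x y] by (auto simp: R_def norm_minus_commute)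
    qed
    show "norm (grad u y) \<le> C2 * norm y powr (- ((q + 1 - \<sigma> - \<tau>) / k))"
    proof (cases "G y = 0")
      case True
      then show ?thesis using C2_pos by simp
    next
      case False
      \<comment> \<open>Near a maximum \<open>c\<close> of \<open>?h\<close> the gradient is at most \<open>2\<^bsup>\<beta>\<^esup>|\<nabla>u(c)|\<close>; the exponent \<open>\<beta>\<close> is the one for
        which \<open>M\<^sup>k d\<^bsup>q+1\<^esup> = (M d\<^sup>\<beta>)\<^sup>k\<close>.\<close>
      let ?h = "\<lambda>x. norm (G x) * (R - dist x y) powr \<beta>"
      have "\<exists>c\<in>cball y R. \<forall>x\<in>cball y R. ?h x \<le> ?h c"
      proof (rule continuous_attains_sup)
        have "continuous_on (cball y R) (\<lambda>x. (R - dist x y) powr \<beta>)"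
          by (rule continuous_on_powr') (use \<beta> in \<open>auto intro!: continuous_intros simp: dist_commute\<close>)
        moreover have "continuous_on (cball y R) G"
          using continuous_on_subset[OF G_cont] cb by (simp add: R_def)
        ultimately show "continuous_on (cball y R) ?h" by (intro continuous_on_mult continuous_on_norm)
      qed (use R in auto)
      then obtain c where c: "c \<in> cball y R" "\<And>x. x \<in> cball y R \<Longrightarrow> ?h x \<le> ?h c" by blast
      define M where "M = norm (G c)"
      define d where "d = R - dist c y"
      \<comment> \<open>The maximality of c is tested at the centre y, whose distance to the
        boundary is R.\<close>
      have hy: "norm (G y) * R powr \<beta> \<le> M * d powr \<beta>"
        using c(2)[of y] R by (simp add: M_def d_def)
      moreover have "norm (G y) * R powr \<beta> > 0" using False R by simp
      ultimately have pos: "M * d powr \<beta> > 0" by linarith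
      have d0: "d \<ge> 0" using c(1) by (simp add: d_def dist_commute)
      have M: "M > 0" and d: "d > 0" using pos d0 by (auto simp: M_def less_le)
      have dR: "d \<le> R" by (simp add: d_def)
      have sub: "x \<in> cball y R" "d / 2 \<le> R - dist x y" if "x \<in> cball c (d / 2)" for x
        using that dist_triangle[of x y c] d by (auto simp: d_def dist_commute)
      have bound: "norm (G x) \<le> 2 powr \<beta> * M" if "x \<in> cball c (d / 2)" for x
      proof -
        have "norm (G x) * (d / 2) powr \<beta> \<le> ?h x"
          using sub(2)[OF that] d \<beta> by (intro mult_left_mono powr_mono2) auto
        also have "\<dots> \<le> M * d powr \<beta>" using c(2)[OF sub(1)[OF that]] by (simp add: M_def d_def)
        also have "d powr \<beta> = 2 powr \<beta> * (d / 2) powr \<beta>" using d by (simp flip: powr_mult)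
        finally have "norm (G x) * (d / 2) powr \<beta> \<le> (2 powr \<beta> * M) * (d / 2) powr \<beta>" by (simp add: mult_ac)
        then show ?thesis using d by simp
      qed
      have "\<exists>x\<in>cball c (d / 2). M powr k * (d / 2) powr (q + 1) * norm x powr (- (\<sigma> + \<tau>)) \<le> C"
      proof (rule est[of S u], intro conjI ballI)
        show "cball c (d / 2) \<subseteq> S" using sub(1) cb by (auto simp: R_def)
        show "d / 2 \<le> norm x" if "x \<in> cball c (d / 2)" for x
          using xR(1)[OF sub(1)[OF that]] dR d by linarith
      qed (use S upos equation M d bound M_def in auto)
      then obtain x where x: "x \<in> cball c (d / 2)" "M powr k * (d / 2) powr (q + 1) * norm x powr (- s) \<le> C"
        unfolding s_def by blast
      have "c3 * R powr (- s) \<le> norm x powr (- s)"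
        using powr_ge_on_interval[of 1 R "norm x" 3 "- s"] xR[OF sub(1)[OF x(1)]] R by (simp add: c3_def)
      then have "M powr k * (d / 2) powr (q + 1) * (c3 * R powr (- s)) \<le> M powr k * (d / 2) powr (q + 1) * norm x powr (- s)"
        by (intro mult_left_mono) auto
      then have 1: "M powr k * (d / 2) powr (q + 1) * (c3 * R powr (- s)) \<le> C" using x(2) by linarith
      \<comment> \<open>The k-th power turns d^\<beta> into d^(q+1), the power of the radius in the
        local estimate, so the unknown d disappears.\<close>
      have "(norm (G y) * R powr \<beta>) powr k \<le> (M * d powr \<beta>) powr k"
        using hy k by (intro powr_mono2) auto
      also have "\<dots> = M powr k * d powr (q + 1)"
        using M d by (simp add: powr_mult powr_powr \<beta>)
      also have "d powr (q + 1) = 2 powr (q + 1) * (d / 2) powr (q + 1)" using d by (simp flip: powr_mult)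
      finally have "(norm (G y) * R powr \<beta>) powr k * (c3 * R powr (- s))
          \<le> 2 powr (q + 1) * (M powr k * (d / 2) powr (q + 1) * (c3 * R powr (- s)))"
        using c3 R by (simp add: mult_ac)
      also have "\<dots> \<le> 2 powr (q + 1) * C" using 1 by (intro mult_left_mono) auto
      finally have "(norm (G y) * R powr \<beta>) powr k * R powr (- s) \<le> C1"
        using c3 by (simp add: C1_def field_simps)
      then have "(norm (G y)) powr k * (R powr (q + 1) * R powr (- s)) \<le> C1"
        using R by (simp add: powr_mult powr_powr \<beta> mult.assoc)
      then have "(norm (G y)) powr k * R powr (q + 1 - s) \<le> C1"
        by (simp flip: powr_add)
      then have "((norm (G y)) powr k * R powr (q + 1 - s)) powr (1 / k) \<le> C1 powr (1 / k)"
        using k by (intro powr_mono2) auto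
      then have "norm (G y) * R powr ((q + 1 - s) / k) \<le> C1 powr (1 / k)"
        using k False R by (simp add: powr_mult powr_powr)
      then have "norm (G y) \<le> C1 powr (1 / k) * R powr (- ((q + 1 - s) / k))"
        using R by (simp add: powr_minus field_simps)
      also have "R powr (- ((q + 1 - s) / k)) = (1 / 2) powr (- ((q + 1 - s) / k)) * norm y powr (- ((q + 1 - s) / k))"
        using y by (simp add: R_def flip: powr_mult)
      also have "q + 1 - s = q + 1 - \<sigma> - \<tau>" by (simp add: s_def)
      finally show ?thesis by (simp add: C2_def s_def mult.assoc diff_diff_eq)
    qed
  qed
qed

section \<open>From the interior estimate to the theorem\<close>

theorem theorem1p1:
  fixes m p q \<sigma> \<tau> k l :: real
  assumes "CARD('n::finite) \<ge> 2"
    and "k = m + q - p + 1"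
    and "l = q + 1 - \<sigma> - \<tau>"
    and "1 < p" and "p \<le> real CARD('n) + \<sigma>"
    and "min k l > 0"
    and "m \<ge> 0" and "q \<ge> 0"
  shows "\<exists>C>0. \<forall>(\<Omega> :: (real^'n) set) u.
           open \<Omega> \<and> connected \<Omega> \<and> 0 \<in> \<Omega> \<and> positive_solution m p q \<sigma> \<tau> \<Omega> u \<longrightarrow>
             (\<forall>r0>0. closure (ball 0 (2 * r0)) \<subseteq> \<Omega> \<longrightarrow>
                (\<forall>x. 0 < norm x \<and> norm x \<le> r0 \<longrightarrow> norm (grad u x) \<le> C * norm x powr (- (l / k)))) \<and>
             (\<Omega> = UNIV \<longrightarrow>
                (\<forall>x. x \<noteq> 0 \<longrightarrow> norm (grad u x) \<le> C * norm x powr (- (l / k))))"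
proof -
  have "k > 0" using assms(6) by simp
  from interior_gradient_estimate[OF assms(4,8,2) this, where ?'n = 'n, of \<sigma> \<tau>, folded assms(3)]
  obtain C where C: "C > 0" and est: "\<And>(S :: (real^'n) set) u y.
    open S \<and> 0 \<notin> S \<and> C2_on S u \<and> (\<forall>x\<in>S. u x > 0) \<and>
    (\<forall>x\<in>S. has_divergence (flux p \<sigma> u) (norm x powr (- \<tau>) * rpow (u x) q * rpow (norm (grad u x)) m) x) \<and>
    y \<noteq> 0 \<and> cball y (norm y / 2) \<subseteq> S \<Longrightarrow>
    norm (grad u y) \<le> C * norm y powr (- (l / k))" by metis
  \<comment> \<open>Both assertions follow from this one: the hypothesis on r0 and the choice of the
    whole space each put the ball of radius 2|x| about 0 inside \<Omega>.\<close>
  have main: "norm (grad u x) \<le> C * norm x powr (- (l / k))"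
    if "open \<Omega>" "positive_solution m p q \<sigma> \<tau> \<Omega> u" "x \<noteq> 0" "ball 0 (2 * norm x) \<subseteq> \<Omega>"
    for \<Omega> :: "(real^'n) set" and u x
  proof (rule est[of "\<Omega> - {0}"], intro conjI)
    \<comment> \<open>Points of this ball have norm between |x|/2 and 3|x|/2, so they avoid the
      origin and stay within radius 2|x|.\<close>
    show "cball x (norm x / 2) \<subseteq> \<Omega> - {0}"
    proof
      fix z assume "z \<in> cball x (norm x / 2)"
      then have z: "norm (x - z) \<le> norm x / 2" by (simp add: dist_norm)
      then have "norm z < 2 * norm x" "z \<noteq> 0"
        using norm_triangle_ineq2[of z x] zero_less_norm_iff[of x] \<open>x \<noteq> 0\<close> unfolding norm_minus_commute[of z x]
        by (linarith, auto)
      then show "z \<in> \<Omega> - {0}" using that(4) by auto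
    qed
  qed (use that in \<open>auto simp: positive_solution_def\<close>)
  show ?thesis
  proof (rule exI[of _ C], intro conjI[OF C] allI impI conjI; elim conjE)
    fix \<Omega> :: "(real^'n) set" and u r0 and x :: "real^'n"
    assume "open \<Omega>" "positive_solution m p q \<sigma> \<tau> \<Omega> u"
      and r0: "closure (ball 0 (2 * r0)) \<subseteq> \<Omega>" "0 < norm x" "norm x \<le> r0"
    moreover have "ball 0 (2 * norm x) \<subseteq> \<Omega>"
    proof (rule order_trans[OF _ r0(1)], rule order_trans[OF _ closure_subset])
      show "ball 0 (2 * norm x) \<subseteq> (ball 0 (2 * r0) :: (real^'n) set)" using r0(3) by (intro subset_ball) simp
    qed
    ultimately show "norm (grad u x) \<le> C * norm x powr (- (l / k))" by (intro main) auto
  next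
    fix \<Omega> :: "(real^'n) set" and u and x :: "real^'n"
    assume "open \<Omega>" "positive_solution m p q \<sigma> \<tau> \<Omega> u" "\<Omega> = UNIV" "x \<noteq> 0"
    then show "norm (grad u x) \<le> C * norm x powr (- (l / k))" by (intro main) auto
  qed
qed

end
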